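(* Assume the Setting and Constants below and that $(L_g,L_c)$ satisfies $(S_2)$. There exists $\varepsilon_0>0$ such that for all $0<\varepsilon<\varepsilon_0$ the following holds: if $\|D^2g\|_0\le\varepsilon$ and $\|D^2k_c\|_0\le\varepsilon$, then $\Theta:\Gamma_1(\delta(\varepsilon))\to\Gamma_1(\delta(\varepsilon))$ is a contraction with respect to the $C^1$ norm, i.e. there is $\lambda<1$ with $\|\Theta(\Lambda)-\Theta(\tilde\Lambda)\|_1\le\lambda\|\Lambda-\tilde\Lambda\|_1$ for all $\Lambda,\tilde\Lambda\in\Gamma_1(\delta(\varepsilon))$.
   Context: Notation. $C^k_b(Y,Z)$ is the Banach space of $C^k$ maps $f:Y\to Z$ between Banach spaces with $\|f\|_k:=\max_{0\le j\le k}\sup_y\|D^jf(y)\|<\infty$ (operator norms). Setting. Let $n\ge2$ be an integer and $X$ a Banach space with $X=X_c\oplus X_u\oplus X_s$ for closed subspaces, whose norm satisfies $\|x\|=\max\{\|x_c\|,\|x_u\|,\|x_s\|\}$. Let $A$ be a bounded linear operator on $X$ leaving $X_c,X_u,X_s$ invariant, with restrictions $A_c,A_u,A_s$; $A_c,A_u$ invertible, $\|A_c^{-1}\|^{\tilde n}\|A_s\|<1$, $\|A_u^{-1}\|\|A_c\|^{\tilde n}<1$ for $1\le\tilde n\le n$. Let $L_g,L_c\ge0$, $F=A+g$ with $g\in C^n_b(X,X)$, $g(0)=0$, $Dg(0)=0$, $\|Dg\|_0\le L_g$, $g=(g_c,g_u,g_s)$; $k_c\in C^n_b(X_c,X_c)$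 with $k_c(0)=0$, $Dk_c(0)=0$, $\|Dk_c\|_0\le L_c$. For $k_u,k_s$ put $K(x):=(x+k_c(x))+k_u(x)+k_s(x)$. Constants. $L_r:=\frac{L_g+L_c(2\|A_c\|+L_g)}{1-L_c}$, $L_t:=\frac{\|A_c^{-1}\|^2L_r}{1-\|A_c^{-1}\|L_r}$, $L_u:=\frac{\|A_u^{-1}\|(1+L_c)L_g}{1-L_r\|A_u^{-1}\|-\|A_c\|\|A_u^{-1}\|}$, $L_s:=\frac{\|A_c^{-1}\|(1+L_c)L_g}{1-L_r\|A_c^{-1}\|-\|A_s\|\|A_c^{-1}\|}$, $L_{-1}:=\|A_c^{-1}\|+L_t$; $\theta_{\tilde n,1}:=L_g+L_c$, $\theta_{\tilde n,2}:=\|A_u^{-1}\|((\|A_c\|+L_r)^{\tilde n}+L_g+L_u)$, $\theta_{\tilde n,3}:=L_{-1}^{\tilde n}(\|A_s\|(1+L_{-1}L_s)+L_g(1+L_{-1}(1+L_c)))$. $(S_N)$ means: $L_c<1$, $L_r\|A_c^{-1}\|<1$, $L_r\|A_u^{-1}\|+\|A_c\|\|A_u^{-1}\|<1$, $L_r\|A_c^{-1}\|+\|A_s\|\|A_c^{-1}\|<1$, and $\theta_{\tilde n,i}<1$ for $i=1,2,3$, $0\le\tilde n\le N$. Operator and sets. $\Theta(r,k_u,k_s):=\big(A_ck_c+g_c\circ K-k_c\circ(A_c+r),\ A_u^{-1}k_u\circ(A_c+r)-A_u^{-1}g_u\circ K,\ A_sk_s\circ(A_c+r)^{-1}+g_s\circ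 K\circ(A_c+r)^{-1}\big)$. $\Gamma_0$: set of $\Lambda=(r,k_u,k_s)\in C^1_b(X_c,X)$ with $\Lambda(0)=0$, $D\Lambda(0)=0$, $\|Dr\|_0\le L_r$, $\|Dk_u\|_0\le L_u$, $\|Dk_s\|_0\le L_s$. For $\delta>0$, $\Gamma_1(\delta)$: set of $\Lambda\in\Gamma_0\cap C^2_b(X_c,X)$ with $\|D^2r\|_0,\|D^2k_u\|_0,\|D^2k_s\|_0\le\delta$. For $\varepsilon>0$: $C_1(\varepsilon):=(\|A_c\|+(1+L_c)^2+L_g+(\|A_c\|+L_r)^2)\varepsilon$, $C_2(\varepsilon):=\|A_u^{-1}\|((1+L_c)^2+L_g)\varepsilon$, $C_3(\varepsilon):=L_{-1}^2((1+L_c)^2+L_g)\varepsilon$, $\delta(\varepsilon):=\max_{i=1,2,3}\frac{C_i(\varepsilon)}{1-\theta_{2,i}}$. *)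

theory Defs
  imports "HOL-Analysis.Analysis"
begin

text \<open>The j-th derivative at a point y is represented as a j-multilinear map, taking
  a list of j directions (the first entry of the list is the direction of the last
  differentiation).  Its norm is the usual multilinear operator norm, which equals the
  operator norm of the corresponding element of L(Y, L(Y, ... L(Y,Z)))).\<close>

definition mlin :: "nat \<Rightarrow> ('a::real_normed_vector list \<Rightarrow> 'b::real_normed_vector) \<Rightarrow> bool" where
  "mlin j M \<longleftrightarrow>
     (\<forall>i<j. \<forall>hs. length hs = j \<longrightarrow> linear (\<lambda>h. M (hs[i := h]))) \<and>
     (\<exists>K. \<forall>hs. length hs = j \<longrightarrow> norm (M hs) \<le> K * prod_list (map norm hs))"

definition mnorm :: "nat \<Rightarrow> ('a::real_normed_vector list \<Rightarrow> 'b::real_normed_vector) \<Rightarrow> real" where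
  "mnorm j M = Sup ((\<lambda>hs. norm (M hs)) ` {hs. length hs = j \<and> (\<forall>h\<in>set hs. norm h \<le> 1)})"

definition has_hderivs :: "nat \<Rightarrow> ('a::real_normed_vector \<Rightarrow> 'b::real_normed_vector)
    \<Rightarrow> (nat \<Rightarrow> 'a \<Rightarrow> 'a list \<Rightarrow> 'b) \<Rightarrow> bool" where
  "has_hderivs n f D \<longleftrightarrow>
     (\<forall>y. D 0 y [] = f y) \<and>
     (\<forall>j\<le>n. \<forall>y. mlin j (D j y)) \<and>
     (\<forall>j<n. \<forall>y. ((\<lambda>h. mnorm j (\<lambda>hs. D j (y + h) hs - D j y hs - D (Suc j) y (h # hs)) / norm h)
                    \<longlongrightarrow> 0) (at 0)) \<and>
     (\<forall>y. ((\<lambda>z. mnorm n (\<lambda>hs. D n z hs - D n y hs)) \<longlongrightarrow> 0) (at y))"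

definition Cb :: "nat \<Rightarrow> ('a::real_normed_vector \<Rightarrow> 'b::real_normed_vector) \<Rightarrow> bool" where
  "Cb n f \<longleftrightarrow> (\<exists>D. has_hderivs n f D \<and> (\<forall>j\<le>n. bdd_above (range (\<lambda>y. mnorm j (D j y)))))"

definition hderiv :: "nat \<Rightarrow> ('a::real_normed_vector \<Rightarrow> 'b::real_normed_vector)
    \<Rightarrow> (nat \<Rightarrow> 'a \<Rightarrow> 'a list \<Rightarrow> 'b)" where
  "hderiv n f = (SOME D. has_hderivs n f D)"

definition Dsup :: "nat \<Rightarrow> ('a::real_normed_vector \<Rightarrow> 'b::real_normed_vector) \<Rightarrow> real" where
  "Dsup j f = (SUP y. mnorm j (hderiv j f j y))"

definition Cnorm :: "nat \<Rightarrow> ('a::real_normed_vector \<Rightarrow> 'b::real_normed_vector) \<Rightarrow> real" where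
  "Cnorm k f = Max ((\<lambda>j. Dsup j f) ` {..k})"

text \<open>Parameters: Lg, Lc, a = ||A_c||, ai = ||A_c^{-1}||, ui = ||A_u^{-1}||, s = ||A_s||.\<close>

definition L_r :: "real \<Rightarrow> real \<Rightarrow> real \<Rightarrow> real" where
  "L_r Lg Lc a = (Lg + Lc * (2 * a + Lg)) / (1 - Lc)"

definition L_t :: "real \<Rightarrow> real \<Rightarrow> real \<Rightarrow> real \<Rightarrow> real" where
  "L_t Lg Lc a ai = ai\<^sup>2 * L_r Lg Lc a / (1 - ai * L_r Lg Lc a)"

definition L_u :: "real \<Rightarrow> real \<Rightarrow> real \<Rightarrow> real \<Rightarrow> real" where
  "L_u Lg Lc a ui = ui * (1 + Lc) * Lg / (1 - L_r Lg Lc a * ui - a * ui)"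

definition L_s :: "real \<Rightarrow> real \<Rightarrow> real \<Rightarrow> real \<Rightarrow> real \<Rightarrow> real" where
  "L_s Lg Lc a ai s = ai * (1 + Lc) * Lg / (1 - L_r Lg Lc a * ai - s * ai)"

definition L_m1 :: "real \<Rightarrow> real \<Rightarrow> real \<Rightarrow> real \<Rightarrow> real" where
  "L_m1 Lg Lc a ai = ai + L_t Lg Lc a ai"

definition theta1 :: "nat \<Rightarrow> real \<Rightarrow> real \<Rightarrow> real" where
  "theta1 m Lg Lc = Lg + Lc"

definition theta2 :: "nat \<Rightarrow> real \<Rightarrow> real \<Rightarrow> real \<Rightarrow> real \<Rightarrow> real" where
  "theta2 m Lg Lc a ui = ui * ((a + L_r Lg Lc a) ^ m + Lg + L_u Lg Lc a ui)"

definition theta3 :: "nat \<Rightarrow> real \<Rightarrow> real \<Rightarrow> real \<Rightarrow> real \<Rightarrow> real \<Rightarrow> real" where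
  "theta3 m Lg Lc a ai s = L_m1 Lg Lc a ai ^ m *
     (s * (1 + L_m1 Lg Lc a ai * L_s Lg Lc a ai s) + Lg * (1 + L_m1 Lg Lc a ai * (1 + Lc)))"

definition S_cond :: "nat \<Rightarrow> real \<Rightarrow> real \<Rightarrow> real \<Rightarrow> real \<Rightarrow> real \<Rightarrow> real \<Rightarrow> bool" where
  "S_cond N Lg Lc a ai ui s \<longleftrightarrow>
     Lc < 1 \<and> L_r Lg Lc a * ai < 1 \<and>
     L_r Lg Lc a * ui + a * ui < 1 \<and>
     L_r Lg Lc a * ai + s * ai < 1 \<and>
     (\<forall>m\<le>N. theta1 m Lg Lc < 1 \<and> theta2 m Lg Lc a ui < 1 \<and> theta3 m Lg Lc a ai s < 1)"

definition C_1 :: "real \<Rightarrow> real \<Rightarrow> real \<Rightarrow> real \<Rightarrow> real" where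
  "C_1 Lg Lc a \<epsilon> = (a + (1 + Lc)\<^sup>2 + Lg + (a + L_r Lg Lc a)\<^sup>2) * \<epsilon>"

definition C_2 :: "real \<Rightarrow> real \<Rightarrow> real \<Rightarrow> real \<Rightarrow> real" where
  "C_2 Lg Lc ui \<epsilon> = ui * ((1 + Lc)\<^sup>2 + Lg) * \<epsilon>"

definition C_3 :: "real \<Rightarrow> real \<Rightarrow> real \<Rightarrow> real \<Rightarrow> real \<Rightarrow> real" where
  "C_3 Lg Lc a ai \<epsilon> = (L_m1 Lg Lc a ai)\<^sup>2 * ((1 + Lc)\<^sup>2 + Lg) * \<epsilon>"

definition delta :: "real \<Rightarrow> real \<Rightarrow> real \<Rightarrow> real \<Rightarrow> real \<Rightarrow> real \<Rightarrow> real \<Rightarrow> real" where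
  "delta Lg Lc a ai ui s \<epsilon> =
     max (C_1 Lg Lc a \<epsilon> / (1 - theta1 2 Lg Lc))
       (max (C_2 Lg Lc ui \<epsilon> / (1 - theta2 2 Lg Lc a ui))
            (C_3 Lg Lc a ai \<epsilon> / (1 - theta3 2 Lg Lc a ai s)))"

text \<open>X is modelled by a Banach type 'x together with isometric copies 'c, 'u, 's of
  X_c, X_u, X_s: jc, ju, js are the inclusions, and the decomposition/max-norm
  hypotheses are stated in the theorem.  Lambda = (r, k_u, k_s) is viewed as the map
  X_c \<rightarrow> X, y \<mapsto> r y + k_u y + k_s y.\<close>

definition emb :: "('c \<Rightarrow> 'x::real_normed_vector) \<Rightarrow> ('u \<Rightarrow> 'x) \<Rightarrow> ('s \<Rightarrow> 'x)
    \<Rightarrow> ('c \<Rightarrow> 'c) \<times> ('c \<Rightarrow> 'u) \<times> ('c \<Rightarrow> 's) \<Rightarrow> 'c \<Rightarrow> 'x" where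
  "emb jc ju js \<Lambda> = (\<lambda>y. jc (fst \<Lambda> y) + ju (fst (snd \<Lambda>) y) + js (snd (snd \<Lambda>) y))"

definition Theta :: "('c::real_normed_vector \<Rightarrow>\<^sub>L 'c) \<Rightarrow> ('u::real_normed_vector \<Rightarrow>\<^sub>L 'u)
    \<Rightarrow> ('s::real_normed_vector \<Rightarrow>\<^sub>L 's)
    \<Rightarrow> ('c \<Rightarrow> 'x::real_normed_vector) \<Rightarrow> ('u \<Rightarrow> 'x) \<Rightarrow> ('s \<Rightarrow> 'x)
    \<Rightarrow> ('x \<Rightarrow> 'c) \<Rightarrow> ('x \<Rightarrow> 'u) \<Rightarrow> ('x \<Rightarrow> 's) \<Rightarrow> ('c \<Rightarrow> 'c)
    \<Rightarrow> ('c \<Rightarrow> 'c) \<times> ('c \<Rightarrow> 'u) \<times> ('c \<Rightarrow> 's) \<Rightarrow> ('c \<Rightarrow> 'c) \<times> ('c \<Rightarrow> 'u) \<times> ('c \<Rightarrow> 's)" where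
  "Theta Ac Aui As jc ju js gc gu gs kc \<Lambda> =
     (let r = fst \<Lambda>; ku = fst (snd \<Lambda>); ks = snd (snd \<Lambda>);
          K = (\<lambda>x. jc (x + kc x) + ju (ku x) + js (ks x));
          Ar = (\<lambda>x. blinfun_apply Ac x + r x);
          Ari = inv Ar
      in (\<lambda>x. blinfun_apply Ac (kc x) + gc (K x) - kc (Ar x),
          \<lambda>x. blinfun_apply Aui (ku (Ar x)) - blinfun_apply Aui (gu (K x)),
          \<lambda>x. blinfun_apply As (ks (Ari x)) + gs (K (Ari x))))"

definition Gamma0 :: "('c::real_normed_vector \<Rightarrow> 'x::real_normed_vector) \<Rightarrow> ('u::real_normed_vector \<Rightarrow> 'x)
    \<Rightarrow> ('s::real_normed_vector \<Rightarrow> 'x) \<Rightarrow> real \<Rightarrow> real \<Rightarrow> real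
    \<Rightarrow> (('c \<Rightarrow> 'c) \<times> ('c \<Rightarrow> 'u) \<times> ('c \<Rightarrow> 's)) set" where
  "Gamma0 jc ju js Lr Lu Ls =
     {\<Lambda>. Cb 1 (emb jc ju js \<Lambda>) \<and> emb jc ju js \<Lambda> 0 = 0 \<and>
          (emb jc ju js \<Lambda> has_derivative (\<lambda>h. 0)) (at 0) \<and>
          Dsup 1 (fst \<Lambda>) \<le> Lr \<and> Dsup 1 (fst (snd \<Lambda>)) \<le> Lu \<and> Dsup 1 (snd (snd \<Lambda>)) \<le> Ls}"

definition Gamma1 :: "('c::real_normed_vector \<Rightarrow> 'x::real_normed_vector) \<Rightarrow> ('u::real_normed_vector \<Rightarrow> 'x)
    \<Rightarrow> ('s::real_normed_vector \<Rightarrow> 'x) \<Rightarrow> real \<Rightarrow> real \<Rightarrow> real \<Rightarrow> real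
    \<Rightarrow> (('c \<Rightarrow> 'c) \<times> ('c \<Rightarrow> 'u) \<times> ('c \<Rightarrow> 's)) set" where
  "Gamma1 jc ju js Lr Lu Ls \<delta> =
     {\<Lambda> \<in> Gamma0 jc ju js Lr Lu Ls. Cb 2 (emb jc ju js \<Lambda>) \<and>
          Dsup 2 (fst \<Lambda>) \<le> \<delta> \<and> Dsup 2 (fst (snd \<Lambda>)) \<le> \<delta> \<and> Dsup 2 (snd (snd \<Lambda>)) \<le> \<delta>}"

end

theory Submission
  imports Defs
begin

text \<open>
  Every first and second derivative of the three components of \<open>\<Theta>\<close> is a sum of compositions of
  derivatives of \<open>g\<close>, \<open>k_c\<close> and the components of \<open>\<Lambda>\<close>, and of the inverse \<open>\<phi>\<close> of \<open>A_c + r\<close>, whose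
  derivative is bounded by \<open>L_{-1} = \<parallel>A_c\<^sup>-\<^sup>1\<parallel> / (1 - L_r \<parallel>A_c\<^sup>-\<^sup>1\<parallel>)\<close>. The constants \<open>L_r\<close>, \<open>L_u\<close>, \<open>L_s\<close>
  are exactly the fixed points of the resulting bounds on the first derivatives, and the second
  derivative of component \<open>i\<close> is bounded by \<open>C_i(\<epsilon>) + \<theta>_{2,i} \<delta>\<close>, which is at most \<open>\<delta> = \<delta>(\<epsilon>)\<close>.
  For two arguments at \<open>C\<^sup>1\<close> distance \<open>d\<close>, the components differ by at most \<open>\<theta>_{0,i} d\<close>, and their
  derivatives by at most \<open>(\<theta>_{1,i} + O(\<epsilon> + \<delta>)) d\<close>. Since \<open>\<delta>(\<epsilon>)\<close> tends to \<open>0\<close> with \<open>\<epsilon>\<close>, both factors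
  are below \<open>1\<close> for small \<open>\<epsilon>\<close>.
\<close>

section \<open>Derivatives as bounded linear maps\<close>

text \<open>Two obstacles shape the proof. Differences such as
  \<open>ku' (A.Ar x) - ku2' (B.Ar x)\<close> compare one derivative at two points, so they need a
  Lipschitz constant of the derivative. The bounds \<epsilon> and \<delta> on second derivatives
  supply it, and therefore the contraction holds in the C1 norm only, one order below the smoothness
  of the set. Moreover \<open>K\<close> mixes the three components, and its derivative is bounded by
  \<open>1 + Lc\<close> only if L_u and L_s are at most \<open>1 + Lc\<close>. This is not part of
  (S_2), but follows from it. The exponents in (S_2) have separate jobs: 2 for invariance of the
  bound \<delta>, 1 for the derivative differences and for L_u, L_s at most \<open>1 + Lc\<close>,
  and 0 for the differences of values. Since X carries the maximum norm, estimates can be made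
  component by component without constants adding up. The derivatives in the statement are
  multilinear maps on lists, selected by a Hilbert choice. They are exchanged for fields of bounded
  linear maps, where chain rule, product rule and inversion are available.\<close>

definition C1 :: "('a::real_normed_vector \<Rightarrow> 'b::real_normed_vector) \<Rightarrow> ('a \<Rightarrow> 'a \<Rightarrow>\<^sub>L 'b) \<Rightarrow> bool"
  where "C1 f f' \<longleftrightarrow> (\<forall>y. (f has_derivative f' y) (at y)) \<and> continuous_on UNIV f'"

section \<open>Multilinear maps of order at most two as bounded linear maps\<close>

lemma length_1_conv: "length hs = Suc 0 \<longleftrightarrow> (\<exists>h. hs = [h])"
  by (cases hs) auto

lemma length_2_conv: "length hs = Suc (Suc 0) \<longleftrightarrow> (\<exists>h k. hs = [h, k])"
  by (cases hs) (auto simp: length_1_conv)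

lemma mnorm_0 [simp]: "mnorm 0 M = norm (M [])"
proof -
  have "(\<lambda>hs. norm (M hs)) ` {hs. length hs = 0 \<and> (\<forall>h\<in>set hs. norm h \<le> 1)} = {norm (M [])}"
    by auto
  then show ?thesis by (simp add: mnorm_def del: length_0_conv)
qed

lemma norm_blinfun_le_unit:
  fixes T :: "'a::real_normed_vector \<Rightarrow>\<^sub>L 'b::real_normed_vector"
  assumes "\<And>h. norm h \<le> 1 \<Longrightarrow> norm (T h) \<le> S"
  shows "norm T \<le> S"
proof (rule norm_blinfun_bound)
  show "0 \<le> S" using assms[of 0] by simp
  show "norm (T h) \<le> S * norm h" for h
  proof (cases "h = 0")
    case False
    have "norm (T (h /\<^sub>R norm h)) \<le> S" by (rule assms) (use False in simp)
    then show ?thesis using False by (simp add: blinfun.scaleR_right field_simps)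
  qed simp
qed

text \<open>The hypothesis speaks of singletons only, because \<open>mnorm\<close> of order one
  samples \<open>M\<close> on lists of length one; elsewhere \<open>M\<close> may be
  arbitrary.\<close>

lemma mnorm_1:
  fixes T :: "'a::real_normed_vector \<Rightarrow>\<^sub>L 'b::real_normed_vector"
  assumes "\<And>h. M [h] = T h"
  shows "mnorm (Suc 0) M = norm T"
proof -
  have *: "norm (T h) \<le> norm T" if "norm h \<le> 1" for h
    using norm_blinfun[of T h] mult_left_le[OF that norm_ge_zero[of T]] by simp
  have "(\<lambda>hs. norm (M hs)) ` {hs. length hs = Suc 0 \<and> (\<forall>h\<in>set hs. norm h \<le> 1)}
      = (\<lambda>h. norm (T h)) ` {h. norm h \<le> 1}" (is "_ = ?R")
    by (force simp: length_1_conv assms image_iff)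
  moreover have "Sup ?R = norm T"
  proof (rule cSup_eq_non_empty)
    show "?R \<noteq> {}" by (auto intro: exI[of _ 0])
    show "x \<le> norm T" if "x \<in> ?R" for x using that * by auto
    show "norm T \<le> S" if "\<And>x. x \<in> ?R \<Longrightarrow> x \<le> S" for S
      using that by (intro norm_blinfun_le_unit) auto
  qed
  ultimately show ?thesis by (simp add: mnorm_def)
qed

lemma mnorm_2:
  fixes T :: "'a::real_normed_vector \<Rightarrow>\<^sub>L 'a \<Rightarrow>\<^sub>L 'b::real_normed_vector"
  assumes "\<And>h k. M [h, k] = T h k"
  shows "mnorm (Suc (Suc 0)) M = norm T"
proof -
  have *: "norm (T h k) \<le> norm T" if "norm h \<le> 1" "norm k \<le> 1" for h k
  proof -
    have "norm (T h k) \<le> norm (T h) * norm k" by (rule norm_blinfun)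
    also have "\<dots> \<le> norm (T h)" using that by (simp add: mult_left_le)
    also have "\<dots> \<le> norm T * norm h" by (rule norm_blinfun)
    also have "\<dots> \<le> norm T" using that by (simp add: mult_left_le)
    finally show ?thesis .
  qed
  have "(\<lambda>hs. norm (M hs)) ` {hs. length hs = Suc (Suc 0) \<and> (\<forall>h\<in>set hs. norm h \<le> 1)}
      = (\<lambda>(h, k). norm (T h k)) ` ({h. norm h \<le> 1} \<times> {k. norm k \<le> 1})" (is "_ = ?R")
    by (force simp: length_2_conv assms image_iff)
  moreover have "Sup ?R = norm T"
  proof (rule cSup_eq_non_empty)
    show "?R \<noteq> {}" by (auto intro: exI[of _ 0])
    show "x \<le> norm T" if "x \<in> ?R" for x using that * by auto
    show "norm T \<le> S" if "\<And>x. x \<in> ?R \<Longrightarrow> x \<le> S" for S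
      using that by (intro norm_blinfun_le_unit) force
  qed
  ultimately show ?thesis by (simp add: mnorm_def)
qed

lemma mlin_0: "mlin 0 M"
  by (auto simp: mlin_def intro: exI[of _ "norm (M [])"])

lemma mlin_1_iff: "mlin (Suc 0) M \<longleftrightarrow> bounded_linear (\<lambda>h. M [h])"
proof
  assume L: "mlin (Suc 0) M"
  then obtain K where "\<forall>hs. length hs = Suc 0 \<longrightarrow> norm (M hs) \<le> K * prod_list (map norm hs)"
    and "\<forall>hs. length hs = Suc 0 \<longrightarrow> linear (\<lambda>h. M (hs[0 := h]))"
    unfolding mlin_def by blast
  from this(1)[rule_format, of "[_]"] this(2)[rule_format, of "[0]"]
  have "linear (\<lambda>h. M [h])" "\<And>h. norm (M [h]) \<le> K * norm h" by simp_all
  then show "bounded_linear (\<lambda>h. M [h])"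
    by (intro bounded_linear_intro[where K = K]) (simp_all add: linear_iff mult.commute)
next
  assume L: "bounded_linear (\<lambda>h. M [h])"
  then obtain K where "\<And>h. norm (M [h]) \<le> norm h * K"
    using bounded_linear.bounded by blast
  then show "mlin (Suc 0) M"
    using L by (auto simp: mlin_def length_1_conv bounded_linear.linear mult.commute intro!: exI[of _ K])
qed

lemma bounded_linear_imp_blinfun:
  "bounded_linear f \<Longrightarrow> \<exists>T. \<forall>h. f h = blinfun_apply T h"
  by (metis bounded_linear_Blinfun_apply)

text \<open>Currying. It makes second derivatives operator-valued maps, and it turns composition of
  operators into a bounded linear map of either factor.\<close>

lemma bounded_bilinear_imp_blinfun:
  assumes "bounded_bilinear B"
  shows "\<exists>T :: 'a::real_normed_vector \<Rightarrow>\<^sub>L 'b::real_normed_vector \<Rightarrow>\<^sub>L 'c::real_normed_vector.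
    \<forall>h k. B h k = T h k"
proof -
  interpret bounded_bilinear B by fact
  have app: "blinfun_apply (Blinfun (B h)) = B h" for h
    by (rule bounded_linear_Blinfun_apply) (rule bounded_linear_right)
  obtain K where K: "\<And>a b. norm (B a b) \<le> norm a * norm b * K" "K \<ge> 0" using nonneg_bounded by blast
  have "bounded_linear (\<lambda>h. Blinfun (B h))"
  proof (rule bounded_linear_intro[where K = K])
    show "norm (Blinfun (B h)) \<le> norm h * K" for h
      using K by (intro norm_blinfun_bound) (auto simp: app algebra_simps)
  qed (auto intro!: blinfun_eqI simp: app add_left scaleR_left blinfun.add_left blinfun.scaleR_left)
  then have "B h k = Blinfun (\<lambda>h. Blinfun (B h)) h k" for h k
    by (simp add: bounded_linear_Blinfun_apply app)
  then show ?thesis by blast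
qed

lemma mlin_2_iff: "mlin (Suc (Suc 0)) M \<longleftrightarrow> bounded_bilinear (\<lambda>h k. M [h, k])"
proof
  assume L: "mlin (Suc (Suc 0)) M"
  then obtain K where K: "\<forall>hs. length hs = Suc (Suc 0) \<longrightarrow> norm (M hs) \<le> K * prod_list (map norm hs)"
    unfolding mlin_def by blast
  have lin: "linear (\<lambda>h. M (hs[i := h]))" if "i < Suc (Suc 0)" "length hs = Suc (Suc 0)" for i hs
    using L that unfolding mlin_def by blast
  have K: "norm (M [h, k]) \<le> K * (norm h * norm k)" for h k
    using K[rule_format, of "[h, k]"] by simp
  \<comment> \<open>The 0 in the varying slot is a placeholder that the list update
    overwrites.\<close>
  have l1: "linear (\<lambda>h. M [h, k])" for k
    using lin[of 0 "[0, k]"] by simp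
  have l2: "linear (\<lambda>k. M [h, k])" for h
    using lin[of 1 "[h, 0]"] by simp
  show "bounded_bilinear (\<lambda>h k. M [h, k])"
    by standard (auto simp: linear_add[OF l1] linear_add[OF l2] linear_scale[OF l1] linear_scale[OF l2]
       intro!: exI[of _ K] order_trans[OF K])
next
  assume "bounded_bilinear (\<lambda>h k. M [h, k])"
  then interpret bounded_bilinear "\<lambda>h k. M [h, k]" .
  obtain K where K: "\<And>a b. norm (M [a, b]) \<le> norm a * norm b * K" using bounded by blast
  show "mlin (Suc (Suc 0)) M"
    unfolding mlin_def
  proof (intro conjI exI[of _ K] allI impI)
    fix i hs assume i: "i < Suc (Suc 0)" and "length (hs :: 'a list) = Suc (Suc 0)"
    then obtain a b where hs: "hs = [a, b]" by (auto simp: length_2_conv)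
    from i consider "i = 0" | "i = 1" by linarith
    then show "linear (\<lambda>h. M (hs[i := h]))"
      by cases (simp_all add: hs bounded_linear.linear[OF bounded_linear_left]
           bounded_linear.linear[OF bounded_linear_right])
  qed (auto simp: length_2_conv K mult.commute[of K])
qed

section \<open>Derivative families of order at most two and C1 maps\<close>

lemma has_hderivs_0_iff: "has_hderivs 0 f D \<longleftrightarrow> (\<forall>y. D 0 y [] = f y) \<and> continuous_on UNIV f"
proof -
  have "((\<lambda>z. norm (f z - f y)) \<longlongrightarrow> 0) (at y) \<longleftrightarrow> (f \<longlongrightarrow> f y) (at y)" for y
    by (simp add: tendsto_norm_zero_iff flip: LIM_zero_iff[where f = f])
  then show ?thesis
    by (auto simp: has_hderivs_def mlin_0 continuous_on_eq_continuous_at isCont_def)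
qed

lemma has_hderivs_1_iff_C1:
  assumes "\<And>y. D 0 y [] = f y" and D1: "\<And>y h. D (Suc 0) y [h] = blinfun_apply (f' y) h"
  shows "has_hderivs (Suc 0) f D \<longleftrightarrow> C1 f f'"
proof -
  have m: "mnorm (Suc 0) (\<lambda>hs. D (Suc 0) z hs - D (Suc 0) y hs) = norm (f' z - f' y)" for z y
    by (rule mnorm_1) (simp add: D1 blinfun.diff_left)
  have c: "((\<lambda>z. norm (f' z - f' y)) \<longlongrightarrow> 0) (at y) \<longleftrightarrow> (f' \<longlongrightarrow> f' y) (at y)" for y
    by (simp add: tendsto_norm_zero_iff flip: LIM_zero_iff[where f = f'])
  show ?thesis
    using assms(1) by (auto simp: has_hderivs_def C1_def D1 m c has_derivative_at blinfun.bounded_linear_right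
      mlin_0 mlin_1_iff le_Suc_eq continuous_on_eq_continuous_at isCont_def)
qed

text \<open>Since the newest direction heads the list, the quotient condition at order one is
  differentiability of \<open>f'\<close> in operator norm with derivative \<open>f''\<close>.
  Continuity of \<open>f'\<close>, which \<open>C1 f f'\<close> demands, then comes for
  free.\<close>

lemma has_hderivs_2_iff_C1:
  fixes f :: "'a::real_normed_vector \<Rightarrow> 'b::real_normed_vector"
    and f'' :: "'a \<Rightarrow> 'a \<Rightarrow>\<^sub>L 'a \<Rightarrow>\<^sub>L 'b"
  assumes "\<And>y. D 0 y [] = f y" and D1: "\<And>y h. D (Suc 0) y [h] = blinfun_apply (f' y) h"
    and D2: "\<And>y h k. D (Suc (Suc 0)) y [h, k] = f'' y h k"
  shows "has_hderivs (Suc (Suc 0)) f D \<longleftrightarrow> C1 f f' \<and> C1 f' f''"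
proof -
  have m: "mnorm (Suc (Suc 0)) (\<lambda>hs. D (Suc (Suc 0)) z hs - D (Suc (Suc 0)) y hs) = norm (f'' z - f'' y)" for z y
    by (rule mnorm_2) (simp add: D2 blinfun.diff_left)
  have m1: "mnorm (Suc 0) (\<lambda>hs. D (Suc 0) (y + h) hs - D (Suc 0) y hs - D (Suc (Suc 0)) y (h # hs))
     = norm (f' (y + h) - f' y - f'' y h)" for y h
    by (rule mnorm_1) (simp add: D1 D2 blinfun.diff_left)
  have c: "((\<lambda>z. norm (f'' z - f'' y)) \<longlongrightarrow> 0) (at y) \<longleftrightarrow> (f'' \<longlongrightarrow> f'' y) (at y)" for y
    by (simp add: tendsto_norm_zero_iff flip: LIM_zero_iff[where f = f''])
  have b: "bounded_bilinear (\<lambda>h k. f'' y h k)" for y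
    by (rule bounded_bilinear.comp1[OF bounded_bilinear_blinfun_apply blinfun.bounded_linear_right])
  have "has_hderivs (Suc (Suc 0)) f D \<longleftrightarrow> (\<forall>y. (f has_derivative f' y) (at y)) \<and> C1 f' f''"
  proof -
    have "mlin j (D j y)" if j: "j \<le> Suc (Suc 0)" for j y
    proof -
      have "j = 0 \<or> j = Suc 0 \<or> j = Suc (Suc 0)" using j by linarith
      then show ?thesis
        by (elim disjE) (simp_all add: mlin_0 mlin_1_iff mlin_2_iff D1 D2 b blinfun.bounded_linear_right)
    qed
    moreover have "(\<forall>j<Suc (Suc 0). P j) \<longleftrightarrow> P 0 \<and> P (Suc 0)" for P
      using less_Suc_eq by auto
    ultimately show ?thesis
      unfolding has_hderivs_def C1_def
      by (simp add: assms(1) D1 m m1 c has_derivative_at blinfun.bounded_linear_right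
          continuous_on_eq_continuous_at isCont_def)
  qed
  also have "\<dots> \<longleftrightarrow> C1 f f' \<and> C1 f' f''"
    unfolding C1_def using has_derivative_continuous_on[of UNIV f' "\<lambda>y. blinfun_apply (f'' y)"] by auto
  finally show ?thesis .
qed

lemma has_hderivs_1_imp_C1:
  assumes "has_hderivs (Suc 0) f D"
  shows "\<exists>f'. C1 f f' \<and> (\<forall>y h. D (Suc 0) y [h] = blinfun_apply (f' y) h)"
proof -
  have "\<exists>f'. \<forall>y. \<forall>h. D (Suc 0) y [h] = blinfun_apply (f' y) h"
  proof (rule choice, rule allI, rule bounded_linear_imp_blinfun)
    show "bounded_linear (\<lambda>h. D (Suc 0) y [h])" for y
      using assms by (simp add: has_hderivs_def flip: mlin_1_iff)
  qed
  then obtain f' where f': "\<And>y h. D (Suc 0) y [h] = blinfun_apply (f' y) h" by blast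
  have "D 0 y [] = f y" for y using assms by (simp add: has_hderivs_def)
  then show ?thesis using has_hderivs_1_iff_C1[of D f f'] f' assms by blast
qed

lemma has_hderivs_2_imp_C1:
  fixes f :: "'a::real_normed_vector \<Rightarrow> 'b::real_normed_vector"
  assumes "has_hderivs (Suc (Suc 0)) f D"
  shows "\<exists>f' f''. C1 f f' \<and> C1 f' f'' \<and> (\<forall>y h. D (Suc 0) y [h] = blinfun_apply (f' y) h)
    \<and> (\<forall>y h k. D (Suc (Suc 0)) y [h, k] = f'' y h k)"
proof -
  have "\<exists>f'. \<forall>y. \<forall>h. D (Suc 0) y [h] = blinfun_apply (f' y) h"
  proof (rule choice, rule allI, rule bounded_linear_imp_blinfun)
    show "bounded_linear (\<lambda>h. D (Suc 0) y [h])" for y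
      using assms by (simp add: has_hderivs_def flip: mlin_1_iff)
  qed
  then obtain f' where f': "\<And>y h. D (Suc 0) y [h] = blinfun_apply (f' y) h" by blast
  have "\<exists>f'' :: 'a \<Rightarrow> 'a \<Rightarrow>\<^sub>L 'a \<Rightarrow>\<^sub>L 'b. \<forall>y. \<forall>h k. D (Suc (Suc 0)) y [h, k] = f'' y h k"
  proof (rule choice, rule allI)
    fix y
    have "bounded_bilinear (\<lambda>h k. D (Suc (Suc 0)) y [h, k])"
      using assms by (simp add: has_hderivs_def flip: mlin_2_iff)
    then show "\<exists>T. \<forall>h k. D (Suc (Suc 0)) y [h, k] = blinfun_apply (blinfun_apply T h) k"
      by (rule bounded_bilinear_imp_blinfun)
  qed
  then obtain f'' :: "'a \<Rightarrow> 'a \<Rightarrow>\<^sub>L 'a \<Rightarrow>\<^sub>L 'b"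
    where f'': "\<And>y h k. D (Suc (Suc 0)) y [h, k] = f'' y h k" by blast
  have "D 0 y [] = f y" for y using assms by (simp add: has_hderivs_def)
  then show ?thesis using has_hderivs_2_iff_C1[of D f f' f''] f' f'' assms by blast
qed

lemma C1_unique: "C1 f f' \<Longrightarrow> C1 f g' \<Longrightarrow> f' = g'"
  by (auto simp: C1_def intro!: ext blinfun_eqI) (metis has_derivative_unique)

lemma C1_imp_hderivs:
  assumes "C1 f f'"
  shows "has_hderivs (Suc 0) f
    (\<lambda>j y hs. if j = 0 then f y else blinfun_apply (f' y) (hs ! 0))"
  using assms by (subst has_hderivs_1_iff_C1[where f' = f']) auto

lemma C2_imp_hderivs:
  assumes "C1 f f'" "C1 f' f''"
  shows "has_hderivs (Suc (Suc 0)) f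
    (\<lambda>j y hs. if j = 0 then f y else if j = Suc 0 then blinfun_apply (f' y) (hs ! 0)
       else blinfun_apply (f'' y (hs ! 0)) (hs ! Suc 0))"
  using assms by (subst has_hderivs_2_iff_C1[where f' = f' and f'' = f'']) auto

section \<open>Suprema of derivatives and bounded C2 maps\<close>

lemma Dsup_0:
  assumes "continuous_on UNIV f"
  shows "Dsup 0 f = (SUP y. norm (f y))"
proof -
  have "\<exists>D. has_hderivs 0 f D"
    using assms by (auto simp: has_hderivs_0_iff intro!: exI[of _ "\<lambda>_ y _. f y"])
  then have "has_hderivs 0 f (hderiv 0 f)"
    unfolding hderiv_def by (rule someI_ex)
  then show ?thesis by (simp add: Dsup_def has_hderivs_0_iff)
qed

text \<open>\<open>hderiv\<close> is a Hilbert choice, hence meaningful only once some derivative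
  family exists. The given \<open>f'\<close> provides one, and uniqueness of derivatives identifies
  the chosen family with it at order one.\<close>

lemma Dsup_1:
  assumes "C1 f f'"
  shows "Dsup (Suc 0) f = (SUP y. norm (f' y))"
proof -
  have "has_hderivs (Suc 0) f (hderiv (Suc 0) f)"
    unfolding hderiv_def using C1_imp_hderivs[OF assms] by (rule someI[where P = "has_hderivs (Suc 0) f"])
  from has_hderivs_1_imp_C1[OF this] obtain g' where g: "C1 f g'"
    and *: "\<And>y h. hderiv (Suc 0) f (Suc 0) y [h] = blinfun_apply (g' y) h"
    by blast
  have "g' = f'" by (rule C1_unique[OF g assms])
  then show ?thesis by (simp add: Dsup_def mnorm_1[OF *])
qed

lemma Dsup_2:
  assumes "C1 f f'" "C1 f' f''"
  shows "Dsup (Suc (Suc 0)) f = (SUP y. norm (f'' y))"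
proof -
  have "has_hderivs (Suc (Suc 0)) f (hderiv (Suc (Suc 0)) f)"
    unfolding hderiv_def using C2_imp_hderivs[OF assms] by (rule someI[where P = "has_hderivs (Suc (Suc 0)) f"])
  from has_hderivs_2_imp_C1[OF this] obtain g' g'' where g: "C1 f g'" "C1 g' g''"
    and *: "\<And>y h k. hderiv (Suc (Suc 0)) f (Suc (Suc 0)) y [h, k] = blinfun_apply (g'' y h) k"
    by blast
  have "g' = f'" by (rule C1_unique[OF g(1) assms(1)])
  with g(2) have "g'' = f''" using C1_unique[OF _ assms(2)] by simp
  then show ?thesis by (simp add: Dsup_def mnorm_2[OF *])
qed

lemma Cb_2_iff:
  fixes f :: "'a::real_normed_vector \<Rightarrow> 'b::real_normed_vector"
  shows "Cb (Suc (Suc 0)) f \<longleftrightarrow> (\<exists>f' f''. C1 f f' \<and> C1 f' f'' \<and> bdd_above (range (\<lambda>y. norm (f y)))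
     \<and> bdd_above (range (\<lambda>y. norm (f' y))) \<and> bdd_above (range (\<lambda>y. norm (f'' y))))" (is "_ \<longleftrightarrow> ?R")
proof
  assume "Cb (Suc (Suc 0)) f"
  then obtain D where D: "has_hderivs (Suc (Suc 0)) f D"
    and bdd: "\<And>j. j \<le> Suc (Suc 0) \<Longrightarrow> bdd_above (range (\<lambda>y. mnorm j (D j y)))"
    unfolding Cb_def by blast
  from has_hderivs_2_imp_C1[OF D] obtain f' f'' where f': "C1 f f'" "C1 f' f''"
    and *: "\<And>y h. D (Suc 0) y [h] = blinfun_apply (f' y) h"
    and **: "\<And>y h k. D (Suc (Suc 0)) y [h, k] = f'' y h k" by blast
  have "D 0 y [] = f y" for y using D by (simp add: has_hderivs_def)
  then show ?R
    using f' bdd[of 0] bdd[of "Suc 0"] bdd[of "Suc (Suc 0)"]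
    by (auto simp: mnorm_1[OF *] mnorm_2[OF **])
next
  assume ?R
  then obtain f' f'' where f': "C1 f f'" "C1 f' f''" "bdd_above (range (\<lambda>y. norm (f y)))"
    "bdd_above (range (\<lambda>y. norm (f' y)))" "bdd_above (range (\<lambda>y. norm (f'' y)))" by blast
  let ?D = "\<lambda>j y hs. if j = 0 then f y else if j = Suc 0 then blinfun_apply (f' y) (hs ! 0)
       else blinfun_apply (f'' y (hs ! 0)) (hs ! Suc 0)"
  have m: "mnorm 0 (?D 0 y) = norm (f y)" "mnorm (Suc 0) (?D (Suc 0) y) = norm (f' y)" 
    "mnorm (Suc (Suc 0)) (?D (Suc (Suc 0)) y) = norm (f'' y)" for y
    by (simp_all add: mnorm_1 mnorm_2)
  have "bdd_above (range (\<lambda>y. mnorm j (?D j y)))" if j: "j \<le> Suc (Suc 0)" for j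
  proof -
    have "j = 0 \<or> j = Suc 0 \<or> j = Suc (Suc 0)" using j by linarith
    then show ?thesis using f' m by (elim disjE) simp_all
  qed
  with C2_imp_hderivs[OF f'(1,2)] show "Cb (Suc (Suc 0)) f" unfolding Cb_def by blast
qed

section \<open>Lowering the order of differentiability\<close>

lemma prod_list_norm_le_1:
  "(\<forall>h\<in>set hs. norm h \<le> 1) \<Longrightarrow> prod_list (map norm hs) \<le> 1"
  "0 \<le> prod_list (map norm hs)"
  by (induction hs) (auto intro: mult_le_one)

lemma mlin_bounded:
  assumes "mlin j M"
  shows "\<exists>K\<ge>0. \<forall>hs. length hs = j \<longrightarrow> norm (M hs) \<le> K * prod_list (map norm hs)"
proof -
  obtain K where K: "\<And>hs. length hs = j \<Longrightarrow> norm (M hs) \<le> K * prod_list (map norm hs)"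
    using assms unfolding mlin_def by blast
  have "norm (M hs) \<le> \<bar>K\<bar> * prod_list (map norm hs)" if "length hs = j" for hs
    using K[OF that] mult_right_mono[OF abs_ge_self[of K] prod_list_norm_le_1(2)[of hs]] by linarith
  then show ?thesis by (intro exI[of _ "\<bar>K\<bar>"]) simp
qed

lemma mlin_bounded_unit:
  assumes "mlin j M"
  shows "\<exists>K\<ge>0. \<forall>hs. length hs = j \<longrightarrow> (\<forall>h\<in>set hs. norm h \<le> 1) \<longrightarrow> norm (M hs) \<le> K"
proof -
  obtain K where K: "K \<ge> 0" "\<And>hs. length hs = j \<Longrightarrow> norm (M hs) \<le> K * prod_list (map norm hs)"
    using mlin_bounded[OF assms] by blast
  have "norm (M hs) \<le> K" if "length hs = j" "\<forall>h\<in>set hs. norm h \<le> 1" for hs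
    using K(2)[OF that(1)] mult_left_le[OF prod_list_norm_le_1(1)[OF that(2)] K(1)] by linarith
  then show ?thesis using K(1) by blast
qed

lemma mnorm_le:
  assumes "\<And>hs. length hs = j \<Longrightarrow> \<forall>h\<in>set hs. norm h \<le> 1 \<Longrightarrow> norm (M hs) \<le> S"
  shows "mnorm j M \<le> S"
  unfolding mnorm_def
proof (rule cSUP_least)
  show "{hs :: 'a list. length hs = j \<and> (\<forall>h\<in>set hs. norm h \<le> 1)} \<noteq> {}"
    by (auto intro!: exI[of _ "replicate j 0"])
qed (use assms in auto)

text \<open>The bound \<open>S\<close> serves only to make the set bounded above; without it the
  real supremum carries no information.\<close>

lemma le_mnorm:
  assumes "\<And>hs. length hs = j \<Longrightarrow> \<forall>h\<in>set hs. norm h \<le> 1 \<Longrightarrow> norm (M hs) \<le> S"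
    and "length hs = j" "\<forall>h\<in>set hs. norm h \<le> 1"
  shows "norm (M hs) \<le> mnorm j M"
  unfolding mnorm_def by (rule cSUP_upper) (use assms in \<open>auto intro!: bdd_aboveI[of _ S]\<close>)

text \<open>The only missing condition is continuity of the m-th derivative, which follows from its
  differentiability. All orders are treated because g and k_c are given as C^n maps with arbitrary n
  at least 2, while the rest of the proof works at order two.\<close>

lemma has_hderivs_Suc_imp:
  fixes f :: "'a::real_normed_vector \<Rightarrow> 'b::real_normed_vector"
  assumes "has_hderivs (Suc m) f D"
  shows "has_hderivs m f D"
proof -
  have "((\<lambda>z. mnorm m (\<lambda>hs. D m z hs - D m y hs)) \<longlongrightarrow> 0) (at y)" for y
  proof -
    let ?R = "\<lambda>h hs. D m (y + h) hs - D m y hs - D (Suc m) y (h # hs)"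
    let ?\<Delta> = "\<lambda>h hs. D m (y + h) hs - D m y hs"
    have ml: "\<And>z. mlin m (D m z)" "mlin (Suc m) (D (Suc m) y)"
      and lim: "((\<lambda>h. mnorm m (?R h) / norm h) \<longlongrightarrow> 0) (at 0)"
      using assms by (auto simp: has_hderivs_def)
    obtain K where K: "K \<ge> 0" "\<And>hs. length hs = Suc m \<Longrightarrow> norm (D (Suc m) y hs) \<le> K * prod_list (map norm hs)"
      using mlin_bounded[OF ml(2)] by blast
    have K': "norm (D (Suc m) y (h # hs)) \<le> K * norm h"
      if "length hs = m" "\<forall>h\<in>set hs. norm h \<le> 1" for h hs
    proof -
      have "norm h * prod_list (map norm hs) \<le> norm h"
        using prod_list_norm_le_1(1)[OF that(2)] by (simp add: mult_left_le)
      then show ?thesis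
        using K(2)[of "h # hs"] that mult_left_mono[OF _ K(1)] by fastforce
    qed
    \<comment> \<open>A finite bound is needed before \<open>mnorm\<close> of the remainder can be
      used as an upper bound.\<close>
    have bdd: "\<exists>S. \<forall>hs. length hs = m \<longrightarrow> (\<forall>h\<in>set hs. norm h \<le> 1) \<longrightarrow> norm (?R h hs) \<le> S" for h
    proof -
      obtain K1 K2 where "\<And>hs. length hs = m \<Longrightarrow> \<forall>h\<in>set hs. norm h \<le> 1 \<Longrightarrow> norm (D m (y + h) hs) \<le> K1"
        "\<And>hs. length hs = m \<Longrightarrow> \<forall>h\<in>set hs. norm h \<le> 1 \<Longrightarrow> norm (D m y hs) \<le> K2"
        using mlin_bounded_unit[OF ml(1)] by metis
      then have "norm (?R h hs) \<le> K1 + K2 + K * norm h"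
        if "length hs = m" "\<forall>h\<in>set hs. norm h \<le> 1" for hs
        using K'[OF that] that by (intro norm_triangle_le_diff add_mono) auto
      then show ?thesis by blast
    qed
    have le: "norm (mnorm m (?\<Delta> h)) \<le> mnorm m (?R h) / norm h * norm h + K * norm h" if "h \<noteq> 0" for h
    proof -
      obtain S where S: "\<And>hs. length hs = m \<Longrightarrow> \<forall>h\<in>set hs. norm h \<le> 1 \<Longrightarrow> norm (?R h hs) \<le> S"
        using bdd[of h] by blast
      have ub: "norm (?\<Delta> h hs) \<le> mnorm m (?R h) + K * norm h"
        if hs: "length hs = m" "\<forall>h\<in>set hs. norm h \<le> 1" for hs
      proof -
        have "?\<Delta> h hs = ?R h hs + D (Suc m) y (h # hs)" by simp
        also have "norm \<dots> \<le> mnorm m (?R h) + K * norm h"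
          by (intro norm_triangle_le add_mono le_mnorm[where S = S] K' S hs)
        finally show ?thesis .
      qed
      have "mnorm m (?\<Delta> h) \<le> mnorm m (?R h) + K * norm h"
        by (rule mnorm_le[OF ub])
      moreover have "norm (?\<Delta> h (replicate m 0)) \<le> mnorm m (?\<Delta> h)"
        by (rule le_mnorm[OF ub]) auto
      ultimately show ?thesis using that order_trans[OF norm_ge_zero] by fastforce
    qed
    have "((\<lambda>h. mnorm m (?\<Delta> h)) \<longlongrightarrow> 0) (at 0)"
    proof (rule Lim_null_comparison)
      show "\<forall>\<^sub>F h in at 0. norm (mnorm m (?\<Delta> h)) \<le> mnorm m (?R h) / norm h * norm h + K * norm h"
        using le by (auto simp: eventually_at_filter)
      show "((\<lambda>h. mnorm m (?R h) / norm h * norm h + K * norm h) \<longlongrightarrow> 0) (at 0)"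
        by (rule tendsto_eq_intros lim refl | simp)+
    qed
    then show ?thesis by (subst LIM_offset_zero_iff[where a = y]) auto
  qed
  then show ?thesis using assms by (auto simp: has_hderivs_def)
qed

lemma Cb_mono:
  assumes "Cb n f" "m \<le> n"
  shows "Cb m f"
proof -
  have "has_hderivs m f D" if "has_hderivs n f D" for D
    using assms(2) that by (induction rule: inc_induct) (auto intro: has_hderivs_Suc_imp)
  then show ?thesis using assms unfolding Cb_def by (meson order_trans)
qed

section \<open>Continuously differentiable maps with bounded derivative\<close>

text \<open>The derivative is hidden by the quantifier. Applied to \<open>f'\<close>, the predicate
  bounds the second derivative without naming it, so that no formula for a second derivative of
  \<Theta> is ever written down.\<close>

definition C1b :: "('a::real_normed_vector \<Rightarrow> 'b::real_normed_vector) \<Rightarrow> real \<Rightarrow> bool"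
  where "C1b f M \<longleftrightarrow> (\<exists>f'. C1 f f' \<and> (\<forall>y. norm (f' y) \<le> M))"

lemma C1bI: "C1 f f' \<Longrightarrow> (\<And>y. norm (f' y) \<le> M) \<Longrightarrow> C1b f M"
  by (auto simp: C1b_def)

lemma C1_continuous_on: "C1 f f' \<Longrightarrow> continuous_on UNIV f"
  unfolding C1_def by (blast intro: continuous_at_imp_continuous_on has_derivative_continuous)

lemma C1_continuous_compose:
  assumes "C1 f f'" "continuous_on UNIV g"
  shows "continuous_on UNIV (\<lambda>x. f (g x))" "continuous_on UNIV (\<lambda>x. f' (g x))"
proof -
  have "continuous_on UNIV f'" using assms(1) by (simp add: C1_def)
  then show "continuous_on UNIV (\<lambda>x. f' (g x))"
    by (rule continuous_on_compose2[OF _ assms(2)]) simp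
  show "continuous_on UNIV (\<lambda>x. f (g x))"
    by (rule continuous_on_compose2[OF C1_continuous_on[OF assms(1)] assms(2)]) simp
qed

lemma C1_id: "C1 (\<lambda>x. x) (\<lambda>_. id_blinfun)"
  by (simp add: C1_def)

lemma C1_add:
  assumes "C1 f f'" "C1 g g'"
  shows "C1 (\<lambda>x. f x + g x) (\<lambda>x. f' x + g' x)"
  using assms unfolding C1_def plus_blinfun.rep_eq
  by (intro conjI allI has_derivative_add continuous_on_add) auto

lemma C1_diff:
  assumes "C1 f f'" "C1 g g'"
  shows "C1 (\<lambda>x. f x - g x) (\<lambda>x. f' x - g' x)"
  using assms unfolding C1_def minus_blinfun.rep_eq
  by (intro conjI allI has_derivative_diff continuous_on_diff) auto

lemma continuous_on_blinfun_compose: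
  assumes "continuous_on S f" "continuous_on S g"
  shows "continuous_on S (\<lambda>x. f x o\<^sub>L g x)"
  using assms by (rule bounded_bilinear.continuous_on[OF bounded_bilinear_blinfun_compose])

lemma C1_compose:
  assumes f: "C1 f f'" and g: "C1 g g'"
  shows "C1 (\<lambda>x. f (g x)) (\<lambda>x. f' (g x) o\<^sub>L g' x)"
proof -
  have "((\<lambda>x. f (g x)) has_derivative (\<lambda>h. f' (g y) (g' y h))) (at y)" for y
    using f g unfolding C1_def by (intro has_derivative_compose[of g _ _ _ f]) auto
  moreover have "continuous_on UNIV (\<lambda>x. f' (g x) o\<^sub>L g' x)"
    using f g C1_continuous_compose(2)[OF f C1_continuous_on[OF g]] unfolding C1_def
    by (intro continuous_on_blinfun_compose) auto
  moreover have "(\<lambda>h. f' (g y) (g' y h)) = blinfun_apply (f' (g y) o\<^sub>L g' y)" for y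
    by (rule ext) simp
  ultimately show ?thesis by (simp add: C1_def)
qed

lemma C1_blinfun: "C1 (blinfun_apply A) (\<lambda>_. A)"
  by (simp add: C1_def bounded_linear_imp_has_derivative blinfun.bounded_linear_right)

lemma C1_blinfun_comp:
  assumes "C1 g g'"
  shows "C1 (\<lambda>x. blinfun_apply A (g x)) (\<lambda>x. A o\<^sub>L g' x)"
  using C1_compose[OF C1_blinfun assms] .

lemma C1_blinfun_compose:
  fixes f :: "'a::real_normed_vector \<Rightarrow> 'b::real_normed_vector \<Rightarrow>\<^sub>L 'c::real_normed_vector"
    and g :: "'a \<Rightarrow> 'd::real_normed_vector \<Rightarrow>\<^sub>L 'b"
  assumes f: "C1 f f'" and g: "C1 g g'"
  shows "\<exists>h'. C1 (\<lambda>x. f x o\<^sub>L g x) h' \<and> (\<forall>x k. h' x k = (f x o\<^sub>L g' x k) + (f' x k o\<^sub>L g x))"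
proof -
  \<comment> \<open>\<open>P\<close> and \<open>Q\<close> are left and right composition as
    operators. They express the derivative as an operator-valued map whose continuity can be read
    off.\<close>
  obtain P :: "('b \<Rightarrow>\<^sub>L 'c) \<Rightarrow>\<^sub>L ('d \<Rightarrow>\<^sub>L 'b) \<Rightarrow>\<^sub>L ('d \<Rightarrow>\<^sub>L 'c)" where P: "\<And>A B. A o\<^sub>L B = P A B"
    using bounded_bilinear_imp_blinfun[OF bounded_bilinear_blinfun_compose] by blast
  obtain Q :: "('d \<Rightarrow>\<^sub>L 'b) \<Rightarrow>\<^sub>L ('b \<Rightarrow>\<^sub>L 'c) \<Rightarrow>\<^sub>L ('d \<Rightarrow>\<^sub>L 'c)" where Q: "\<And>A B. A o\<^sub>L B = Q B A"
    using bounded_bilinear_imp_blinfun[OF bounded_bilinear.flip[OF bounded_bilinear_blinfun_compose]] by blast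
  let ?h' = "\<lambda>x. (P (f x) o\<^sub>L g' x) + (Q (g x) o\<^sub>L f' x)"
  have h': "?h' x k = (f x o\<^sub>L g' x k) + (f' x k o\<^sub>L g x)" for x k
    by (simp add: P[symmetric] Q[symmetric] plus_blinfun.rep_eq)
  have "((\<lambda>x. f x o\<^sub>L g x) has_derivative ?h' x) (at x)" for x
  proof -
    have "((\<lambda>x. f x o\<^sub>L g x) has_derivative (\<lambda>k. (f x o\<^sub>L g' x k) + (f' x k o\<^sub>L g x))) (at x)"
      by (rule bounded_bilinear.FDERIV[OF bounded_bilinear_blinfun_compose])
         (use f g in \<open>auto simp: C1_def\<close>)
    moreover have "(\<lambda>k. (f x o\<^sub>L g' x k) + (f' x k o\<^sub>L g x)) = blinfun_apply (?h' x)"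
      by (rule ext) (rule h'[symmetric])
    ultimately show ?thesis by simp
  qed
  moreover have "continuous_on UNIV ?h'"
    using f g C1_continuous_on[OF f] C1_continuous_on[OF g] unfolding C1_def
    by (intro continuous_on_add continuous_on_blinfun_compose
         bounded_linear.continuous_on[OF blinfun.bounded_linear_right]) auto
  ultimately show ?thesis
    unfolding C1_def by (intro exI[of _ ?h'] conjI allI h') auto
qed

lemma C1b_nonneg: "C1b f M \<Longrightarrow> 0 \<le> M"
  unfolding C1b_def using norm_ge_zero order_trans by blast

lemma C1b_mono: "C1b f M \<Longrightarrow> M \<le> N \<Longrightarrow> C1b f N"
  unfolding C1b_def by (meson order_trans)

lemma C1_lipschitz:
  assumes "C1 f f'" "\<And>y. norm (f' y) \<le> M"
  shows "norm (f x - f y) \<le> M * norm (x - y)"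
  using assms(1) unfolding C1_def
  by (intro differentiable_bound[of UNIV f "\<lambda>y. blinfun_apply (f' y)"])
     (auto simp: assms(2) simp flip: norm_blinfun.rep_eq)

lemma C1b_lipschitz: "C1b f M \<Longrightarrow> norm (f x - f y) \<le> M * norm (x - y)"
  unfolding C1b_def using C1_lipschitz by blast

lemma C1b_const: "C1b (\<lambda>_. c) 0"
  by (rule C1bI[where f' = "\<lambda>_. 0"]) (auto simp: C1_def zero_blinfun.rep_eq)

lemma C1b_add:
  assumes "C1b f M" "C1b g N" shows "C1b (\<lambda>x. f x + g x) (M + N)"
proof -
  obtain f' g' where "C1 f f'" "\<And>x. norm (f' x) \<le> M" "C1 g g'" "\<And>x. norm (g' x) \<le> N"
    using assms unfolding C1b_def by blast
  then show ?thesis by (intro C1bI[OF C1_add] norm_triangle_mono)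
qed

lemma C1b_diff:
  assumes "C1b f M" "C1b g N" shows "C1b (\<lambda>x. f x - g x) (M + N)"
proof -
  obtain f' g' where "C1 f f'" "\<And>x. norm (f' x) \<le> M" "C1 g g'" "\<And>x. norm (g' x) \<le> N"
    using assms unfolding C1b_def by blast
  then show ?thesis by (intro C1bI[OF C1_diff] order_trans[OF norm_triangle_ineq4 add_mono])
qed

lemma C1b_lipschitz_le: "C1b f M \<Longrightarrow> norm (x - y) \<le> N \<Longrightarrow> norm (f x - f y) \<le> M * N"
  using C1b_lipschitz[of f M x y] mult_left_mono[of "norm (x - y)" N M] C1b_nonneg[of f M] by linarith

lemma norm_compose_le:
  "norm (A :: 'b::real_normed_vector \<Rightarrow>\<^sub>L 'c::real_normed_vector) \<le> M \<Longrightarrow> norm B \<le> N \<Longrightarrow> norm (A o\<^sub>L B) \<le> M * N"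
  by (meson norm_blinfun_compose mult_mono norm_ge_zero order_trans)

lemma norm_apply_le:
  "norm (A :: 'b::real_normed_vector \<Rightarrow>\<^sub>L 'c::real_normed_vector) \<le> M \<Longrightarrow> norm x \<le> N \<Longrightarrow> norm (A x) \<le> M * N"
  by (meson norm_blinfun mult_mono norm_ge_zero order_trans)

lemma C1b_compose:
  assumes "C1b f M" "C1b g N" shows "C1b (\<lambda>x. f (g x)) (M * N)"
proof -
  obtain f' g' where "C1 f f'" "\<And>x. norm (f' x) \<le> M" "C1 g g'" "\<And>x. norm (g' x) \<le> N"
    using assms unfolding C1b_def by blast
  then show ?thesis by (intro C1bI[OF C1_compose] norm_compose_le)
qed

lemma C1b_blinfun_compose:
  fixes f :: "'a::real_normed_vector \<Rightarrow> 'b::real_normed_vector \<Rightarrow>\<^sub>L 'c::real_normed_vector"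
    and g :: "'a \<Rightarrow> 'd::real_normed_vector \<Rightarrow>\<^sub>L 'b"
  assumes f: "C1b f M'" and g: "C1b g N'"
    and M: "\<And>x. norm (f x) \<le> M" and N: "\<And>x. norm (g x) \<le> N"
  shows "C1b (\<lambda>x. f x o\<^sub>L g x) (M' * N + M * N')"
proof -
  obtain f' g' where f': "C1 f f'" "\<And>x. norm (f' x) \<le> M'" and g': "C1 g g'" "\<And>x. norm (g' x) \<le> N'"
    using f g unfolding C1b_def by blast
  obtain h' where h: "C1 (\<lambda>x. f x o\<^sub>L g x) h'"
    and h': "\<And>x k. h' x k = (f x o\<^sub>L g' x k) + (f' x k o\<^sub>L g x)"
    using C1_blinfun_compose[OF f'(1) g'(1)] by blast
  show ?thesis
  proof (rule C1bI[OF h], rule norm_blinfun_bound)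
    have "0 \<le> M" "0 \<le> N" using norm_ge_zero M N order_trans by blast+
    then show "0 \<le> M' * N + M * N'" using C1b_nonneg[OF f] C1b_nonneg[OF g] by simp
    show "norm (h' y k) \<le> (M' * N + M * N') * norm k" for y k
    proof -
      have "norm (h' y k) \<le> M * (N' * norm k) + (M' * norm k) * N"
        unfolding h' by (intro norm_triangle_mono norm_compose_le norm_apply_le M N f' g' order_refl)
      then show ?thesis by (simp add: algebra_simps)
    qed
  qed
qed

text \<open>The general product estimate also asks for a bound on \<open>g\<close>; with a constant
  left factor the derivative is \<open>A\<close> composed with \<open>g'\<close>, and the bound on
  \<open>g'\<close> suffices.\<close>

lemma C1b_blinfun_compose_const:
  fixes A :: "'b::real_normed_vector \<Rightarrow>\<^sub>L 'c::real_normed_vector"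
    and g :: "'a::real_normed_vector \<Rightarrow> 'd::real_normed_vector \<Rightarrow>\<^sub>L 'b"
  assumes "C1b g N'"
  shows "C1b (\<lambda>x. A o\<^sub>L g x) (norm A * N')"
proof -
  obtain g' where g': "C1 g g'" "\<And>x. norm (g' x) \<le> N'"
    using assms unfolding C1b_def by blast
  have "C1 (\<lambda>_::'a. A) (\<lambda>_. 0)" by (simp add: C1_def zero_blinfun.rep_eq)
  from C1_blinfun_compose[OF this g'(1)] obtain h' where h: "C1 (\<lambda>x. A o\<^sub>L g x) h'"
    and h': "\<And>x k. h' x k = A o\<^sub>L g' x k"
    by (auto simp: zero_blinfun.rep_eq)
  show ?thesis
  proof (rule C1bI[OF h], rule norm_blinfun_bound)
    show "0 \<le> norm A * N'" using C1b_nonneg[OF assms] by simp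
    show "norm (h' y k) \<le> norm A * N' * norm k" for y k
      unfolding h' mult.assoc by (intro norm_compose_le norm_apply_le g' order_refl)
  qed
qed

text \<open>The maximum norm keeps the common constant \<open>M\<close> instead of a sum of three.
  The inclusions are abstract so that the result also applies to operator-valued maps, with
  composition by \<open>Jc\<close>, \<open>Ju\<close>, \<open>Js\<close> as inclusions.\<close>

lemma C1b_glue:
  assumes J: "bounded_linear J1" "bounded_linear J2" "bounded_linear J3"
    and J_norm: "\<And>a b c. norm (J1 a + J2 b + J3 c) \<le> max (norm a) (max (norm b) (norm c))"
    and f: "C1b f1 M" "C1b f2 M" "C1b f3 M"
  shows "C1b (\<lambda>x. J1 (f1 x) + J2 (f2 x) + J3 (f3 x)) M"
proof -
  obtain f1' f2' f3' where f': "C1 f1 f1'" "C1 f2 f2'" "C1 f3 f3'"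
    and M: "\<And>x. norm (f1' x) \<le> M" "\<And>x. norm (f2' x) \<le> M" "\<And>x. norm (f3' x) \<le> M"
    using f unfolding C1b_def by blast
  obtain B1 B2 B3 where B: "J1 = blinfun_apply B1" "J2 = blinfun_apply B2" "J3 = blinfun_apply B3"
    using J bounded_linear_Blinfun_apply by metis
  have D: "C1 (\<lambda>x. J1 (f1 x) + J2 (f2 x) + J3 (f3 x))
      (\<lambda>x. (B1 o\<^sub>L f1' x) + (B2 o\<^sub>L f2' x) + (B3 o\<^sub>L f3' x))"
    unfolding B by (intro C1_add C1_blinfun_comp f')
  show ?thesis
  proof (rule C1bI[OF D], rule norm_blinfun_bound)
    show "0 \<le> M" by (rule C1b_nonneg[OF f(1)])
    show "norm (((B1 o\<^sub>L f1' x) + (B2 o\<^sub>L f2' x) + (B3 o\<^sub>L f3' x)) h) \<le> M * norm h" for x h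
      using J_norm[of "f1' x h" "f2' x h" "f3' x h"]
        norm_apply_le[OF M(1) order_refl, of x h] norm_apply_le[OF M(2) order_refl, of x h] 
        norm_apply_le[OF M(3) order_refl, of x h]
      by (simp add: plus_blinfun.rep_eq B)
  qed
qed

section \<open>Inverses of perturbed isomorphisms\<close>

lemma has_derivative_zero_quadratic:
  assumes "\<And>z. norm (E z) \<le> k * (norm (z - y))\<^sup>2"
  shows "(E has_derivative (\<lambda>h. 0)) (at y)"
proof (rule has_derivativeI_sandwich[where e = 1 and H = "\<lambda>z. k * norm (z - y)"])
  have "E y = 0" using assms[of y] by simp
  then show "norm (E z - E y - 0) / norm (z - y) \<le> k * norm (z - y)" if "z \<noteq> y" for z
    using assms[of z] that by (simp add: divide_le_eq power2_eq_square mult.assoc)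
  show "((\<lambda>z. k * norm (z - y)) \<longlongrightarrow> 0) (at y)"
    by (rule tendsto_eq_intros refl | simp)+
qed auto

text \<open>The resolvent identity. Only \<open>W\<close> as left inverse of \<open>B\<close> and
  \<open>W'\<close> as right inverse of \<open>B'\<close> enter, so domain and codomain may
  differ.\<close>

lemma inverse_diff_identity:
  assumes "W o\<^sub>L B = id_blinfun" "B' o\<^sub>L W' = id_blinfun"
  shows "W - W' = - (W o\<^sub>L ((B - B') o\<^sub>L W'))"
proof -
  have "W o\<^sub>L ((B - B') o\<^sub>L W') = ((W o\<^sub>L B) o\<^sub>L W') - (W o\<^sub>L (B' o\<^sub>L W'))"
    by (intro blinfun_eqI) (simp add: blinfun.diff_left blinfun.diff_right)
  also have "\<dots> = W' - W"
    by (simp only: assms) (intro blinfun_eqI, simp add: blinfun.diff_left)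
  finally show ?thesis by simp
qed

lemma norm_inverse_diff_le:
  assumes "W o\<^sub>L B = id_blinfun" "B' o\<^sub>L W' = id_blinfun" "norm W \<le> w" "norm W' \<le> w'" "norm (B - B') \<le> b"
  shows "norm (W - W') \<le> w * (b * w')"
  unfolding inverse_diff_identity[OF assms(1,2)] norm_minus_cancel
  by (intro norm_compose_le assms)

text \<open>Differentiation of an inverse: the derivative in direction \<open>h\<close> is
  \<open>- W (B' h) W\<close>. The resolvent identity first shows that \<open>W\<close> is
  Lipschitz.\<close>

lemma C1b_inverse_operator:
  fixes B :: "'a::real_normed_vector \<Rightarrow> 'b::real_normed_vector \<Rightarrow>\<^sub>L 'c::real_normed_vector"
  assumes B: "C1b B M" and WB: "\<And>y. W y o\<^sub>L B y = id_blinfun" "\<And>y. B y o\<^sub>L W y = id_blinfun"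
    and w: "\<And>y. norm (W y) \<le> w"
  shows "C1b W (w * M * w)"
proof -
  obtain B' where B': "C1 B B'" "\<And>y. norm (B' y) \<le> M" using B unfolding C1b_def by blast
  have w0: "0 \<le> w" using w norm_ge_zero order_trans by blast
  have M0: "0 \<le> M" by (rule C1b_nonneg[OF B])
  have lip: "norm (W z - W y) \<le> w * ((M * norm (z - y)) * w)" for z y
    by (intro norm_inverse_diff_le[OF WB] w C1b_lipschitz[OF B])
  have contW: "continuous_on UNIV W"
  proof (rule lipschitz_on_continuous_on, rule lipschitz_onI)
    show "dist (W z) (W y) \<le> (w * M * w) * dist z y" for z y
      using lip[of z y] by (simp add: dist_norm mult_ac)
  qed (use w0 M0 in simp)
  obtain P :: "('c \<Rightarrow>\<^sub>L 'b) \<Rightarrow>\<^sub>L ('b \<Rightarrow>\<^sub>L 'c) \<Rightarrow>\<^sub>L ('b \<Rightarrow>\<^sub>L 'b)" where P: "\<And>A B. A o\<^sub>L B = P A B"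
    using bounded_bilinear_imp_blinfun[OF bounded_bilinear_blinfun_compose] by blast
  obtain Q :: "('c \<Rightarrow>\<^sub>L 'b) \<Rightarrow>\<^sub>L ('b \<Rightarrow>\<^sub>L 'b) \<Rightarrow>\<^sub>L ('c \<Rightarrow>\<^sub>L 'b)" where Q: "\<And>A B. A o\<^sub>L B = Q B A"
    using bounded_bilinear_imp_blinfun[OF bounded_bilinear.flip[OF bounded_bilinear_blinfun_compose]] by blast
  let ?W' = "\<lambda>y. - (Q (W y) o\<^sub>L (P (W y) o\<^sub>L B' y))"
  have W': "?W' y h = - ((W y o\<^sub>L B' y h) o\<^sub>L W y)" for y h
    by (simp add: P[symmetric] Q[symmetric] uminus_blinfun.rep_eq)
  have "(W has_derivative ?W' y) (at y)" for y
  proof -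
    let ?L = "\<lambda>C. - ((W y o\<^sub>L C) o\<^sub>L W y)"
    have bl: "bounded_linear ?L"
      by (intro bounded_linear_minus
        bounded_linear_compose[OF bounded_bilinear.bounded_linear_left[OF bounded_bilinear_blinfun_compose]]
        bounded_bilinear.bounded_linear_right[OF bounded_bilinear_blinfun_compose])
    \<comment> \<open>Replacing \<open>W z\<close> by \<open>W y\<close> in the resolvent identity
      leaves this error, a product of two Lipschitz differences, hence quadratic in the
      distance.\<close>
    let ?E = "\<lambda>z. - ((W z - W y) o\<^sub>L ((B z - B y) o\<^sub>L W y))"
    have eq: "W z = W y + ?L (B z - B y) + ?E z" for z
    proof -
      have "W z - W y = - (W z o\<^sub>L ((B z - B y) o\<^sub>L W y))"
        by (rule inverse_diff_identity[OF WB])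
      also have "\<dots> = ?L (B z - B y) + ?E z"
        by (intro blinfun_eqI) (simp add: blinfun.diff_left blinfun.add_left blinfun.minus_left)
      finally show ?thesis by (simp add: algebra_simps)
    qed
    have "(?E has_derivative (\<lambda>h. 0)) (at y)"
    proof (rule has_derivative_zero_quadratic)
      show "norm (?E z) \<le> (w * M * w * M * w) * (norm (z - y))\<^sup>2" for z
      proof -
        have "norm (?E z) \<le> (w * ((M * norm (z - y)) * w)) * ((M * norm (z - y)) * w)"
          unfolding norm_minus_cancel by (intro norm_compose_le lip C1b_lipschitz[OF B] w)
        then show ?thesis by (simp add: power2_eq_square mult_ac)
      qed
    qed
    moreover have "((\<lambda>z. ?L (B z - B y)) has_derivative (\<lambda>h. ?L (B' y h - 0))) (at y)"
      using B'(1) unfolding C1_def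
      by (intro bounded_linear.has_derivative[OF bl] has_derivative_diff has_derivative_const) auto
    ultimately have "((\<lambda>z. W y + ?L (B z - B y) + ?E z) has_derivative (\<lambda>h. 0 + ?L (B' y h - 0) + 0)) (at y)"
      by (intro has_derivative_add has_derivative_const)
    moreover have "(\<lambda>h. 0 + ?L (B' y h - 0) + 0) = blinfun_apply (?W' y)"
      by (rule ext) (simp only: W', simp)
    moreover have "(\<lambda>z. W y + ?L (B z - B y) + ?E z) = W"
      by (rule ext) (rule eq[symmetric])
    ultimately show ?thesis by (simp only:)
  qed
  moreover have "continuous_on UNIV ?W'"
    using B'(1) contW unfolding C1_def
    by (intro continuous_on_minus continuous_on_blinfun_compose
         bounded_linear.continuous_on[OF blinfun.bounded_linear_right]) auto
  ultimately have D: "C1 W ?W'" by (simp add: C1_def)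
  show ?thesis
  proof (rule C1bI[OF D], rule norm_blinfun_bound)
    show "0 \<le> w * M * w" using w0 M0 by simp
    show "norm (?W' y h) \<le> w * M * w * norm h" for y h
    proof -
      have "norm (?W' y h) \<le> (w * (M * norm h)) * w"
        unfolding W' norm_minus_cancel by (intro norm_compose_le norm_apply_le w B' order_refl)
      then show ?thesis by (simp add: mult_ac)
    qed
  qed
qed

text \<open>With \<open>x = Ai v\<close> the equation \<open>A x + r x = z\<close> becomes the fixed
  point equation \<open>v = z - r (Ai v)\<close>, a contraction with factor
  \<open>L * norm Ai\<close> on the complete codomain. The second estimate gives uniqueness and the
  Lipschitz constant of the inverse.\<close>

lemma perturbed_iso_bij:
  fixes A :: "'a::real_normed_vector \<Rightarrow>\<^sub>L 'b::banach" and r :: "'a \<Rightarrow> 'b"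
  assumes inv: "A o\<^sub>L Ai = id_blinfun" "Ai o\<^sub>L A = id_blinfun"
    and r: "\<And>x y. norm (r x - r y) \<le> L * norm (x - y)"
    and L: "0 \<le> L" "L * norm Ai < 1"
  shows "bij (\<lambda>x. A x + r x)"
    and "norm (x - y) \<le> norm Ai / (1 - L * norm Ai) * norm ((A x + r x) - (A y + r y))"
proof -
  have Ai: "Ai (A x) = x" "A (Ai z) = z" for x z
    using blinfun_apply_blinfun_compose[of A Ai] blinfun_apply_blinfun_compose[of Ai A]
    by (simp_all add: inv)
  show *: "norm (x - y) \<le> norm Ai / (1 - L * norm Ai) * norm ((A x + r x) - (A y + r y))" for x y
  proof -
    have "x - y = Ai ((A x + r x) - (A y + r y)) - Ai (r x - r y)"
      by (simp add: Ai blinfun.diff_right blinfun.add_right)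
    also have "norm \<dots> \<le> norm Ai * norm ((A x + r x) - (A y + r y)) + norm Ai * (L * norm (x - y))"
      by (intro norm_triangle_le_diff add_mono norm_apply_le r order_refl)
    finally show ?thesis using L by (simp add: field_simps)
  qed
  have "\<exists>!x. A x + r x = z" for z
  proof -
    let ?f = "\<lambda>v. z - r (Ai v)"
    have "\<exists>!v. ?f v = v"
    proof (rule banach_fix_type[where c = "L * norm Ai"])
      show "\<forall>u v. dist (?f u) (?f v) \<le> L * norm Ai * dist u v"
      proof (intro allI)
        fix u v
        have "dist (?f u) (?f v) = norm (r (Ai u) - r (Ai v))"
          by (simp add: dist_norm norm_minus_commute)
        also have "\<dots> \<le> L * norm (Ai (u - v))" using r by (simp add: blinfun.diff_right)
        also have "\<dots> \<le> L * (norm Ai * norm (u - v))"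
          by (intro mult_left_mono norm_blinfun L)
        finally show "dist (?f u) (?f v) \<le> L * norm Ai * dist u v" by (simp add: dist_norm mult_ac)
      qed
    qed (use L in auto)
    then obtain v where "z - r (Ai v) = v" by auto
    then have v: "A (Ai v) + r (Ai v) = z" by (simp add: Ai algebra_simps)
    show ?thesis
    proof (rule ex1I[of _ "Ai v"])
      show "A (Ai v) + r (Ai v) = z" by (rule v)
      show "x = Ai v" if "A x + r x = z" for x
        using *[of x "Ai v"] that v by simp
    qed
  qed
  then show "bij (\<lambda>x. A x + r x)" by (simp add: bij_iff)
qed

text \<open>The linear case takes the place of a Neumann series: the nonlinear result is applied
  with the operator \<open>B\<close> as perturbation, and linearity passes to the inverse.\<close>

lemma perturbed_iso_inverse:
  fixes A B :: "'a::real_normed_vector \<Rightarrow>\<^sub>L 'b::banach"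
  assumes inv: "A o\<^sub>L Ai = id_blinfun" "Ai o\<^sub>L A = id_blinfun"
    and L: "norm B \<le> L" "L * norm Ai < 1"
  shows "\<exists>W. W o\<^sub>L (A + B) = id_blinfun \<and> (A + B) o\<^sub>L W = id_blinfun
    \<and> norm W \<le> norm Ai / (1 - L * norm Ai)"
proof -
  let ?T = "\<lambda>x. A x + B x"
  have L0: "0 \<le> L" using L(1) norm_ge_zero order_trans by blast
  have B: "norm (B x - B y) \<le> L * norm (x - y)" for x y
    using norm_apply_le[OF L(1) order_refl, of "x - y"] by (simp add: blinfun.diff_right)
  note p = perturbed_iso_bij[OF inv B L0 L(2)]
  have T: "?T (inv ?T z) = z" "inv ?T (?T x) = x" for x z
    using surj_f_inv_f[OF bij_is_surj[OF p(1)]] inv_f_f[OF bij_is_inj[OF p(1)]] by auto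
  have lin: "linear ?T" by (intro bounded_linear.linear bounded_linear_add blinfun.bounded_linear_right)
  have "bounded_linear (inv ?T)"
  proof (rule bounded_linear_intro[where K = "norm Ai / (1 - L * norm Ai)"])
    show "inv ?T (x + y) = inv ?T x + inv ?T y" for x y
    proof -
      have "x + y = ?T (inv ?T x + inv ?T y)" by (simp only: linear_add[OF lin] T(1))
      then show ?thesis by (simp only: T(2))
    qed
    show "inv ?T (c *\<^sub>R x) = c *\<^sub>R inv ?T x" for c x
    proof -
      have "c *\<^sub>R x = ?T (c *\<^sub>R inv ?T x)" by (simp only: linear_scale[OF lin] T(1))
      then show ?thesis by (simp only: T(2))
    qed
    show "norm (inv ?T x) \<le> norm x * (norm Ai / (1 - L * norm Ai))" for x
      using p(2)[of "inv ?T x" 0] by (simp add: T mult.commute)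
  qed
  then obtain W where W: "\<And>x. inv ?T x = blinfun_apply W x"
    using bounded_linear_imp_blinfun by blast
  have "norm W \<le> norm Ai / (1 - L * norm Ai)"
  proof (rule norm_blinfun_bound)
    show "norm (W x) \<le> norm Ai / (1 - L * norm Ai) * norm x" for x
      using p(2)[of "inv ?T x" 0] by (simp add: T flip: W)
  qed (use L in simp)
  moreover have "W o\<^sub>L (A + B) = id_blinfun" "(A + B) o\<^sub>L W = id_blinfun"
    by (intro blinfun_eqI, simp add: T blinfun.add_left flip: W)+
  ultimately show ?thesis by blast
qed

text \<open>Candidates for the derivative are the pointwise inverses of
  \<open>A + r' (\<phi> y)\<close>. The Lipschitz bound makes \<open>\<phi>\<close> continuous,
  which is what the inverse function rule asks for; continuity of \<open>\<phi>'\<close> comes from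
  the resolvent identity.\<close>

lemma perturbed_iso_C1_inverse:
  fixes A :: "'a::banach \<Rightarrow>\<^sub>L 'a" and r :: "'a \<Rightarrow> 'a"
  assumes inv: "A o\<^sub>L Ai = id_blinfun" "Ai o\<^sub>L A = id_blinfun"
    and r: "C1 r r'" "\<And>y. norm (r' y) \<le> L" and L: "L * norm Ai < 1"
  defines "\<phi> \<equiv> inv (\<lambda>x. A x + r x)"
  shows "\<exists>\<phi>'. C1 \<phi> \<phi>' \<and> (\<forall>y. \<phi>' y o\<^sub>L (A + r' (\<phi> y)) = id_blinfun
    \<and> (A + r' (\<phi> y)) o\<^sub>L \<phi>' y = id_blinfun \<and> norm (\<phi>' y) \<le> norm Ai / (1 - L * norm Ai))"
proof -
  let ?w = "norm Ai / (1 - L * norm Ai)"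
  have L0: "0 \<le> L" using r(2) norm_ge_zero order_trans by blast
  have w0: "0 \<le> ?w" using L by simp
  note p = perturbed_iso_bij[OF inv C1_lipschitz[OF r] L0 L]
  have \<phi>: "A (\<phi> z) + r (\<phi> z) = z" for z
    using bij_is_surj[OF p(1)] unfolding \<phi>_def by (rule surj_f_inv_f)
  have "\<exists>\<phi>'. \<forall>y. \<phi>' y o\<^sub>L (A + r' (\<phi> y)) = id_blinfun
    \<and> (A + r' (\<phi> y)) o\<^sub>L \<phi>' y = id_blinfun \<and> norm (\<phi>' y) \<le> ?w"
    by (rule choice, rule allI, rule perturbed_iso_inverse[OF inv r(2) L])
  then obtain \<phi>' where \<phi>': "\<And>y. \<phi>' y o\<^sub>L (A + r' (\<phi> y)) = id_blinfun"
    "\<And>y. (A + r' (\<phi> y)) o\<^sub>L \<phi>' y = id_blinfun" "\<And>y. norm (\<phi>' y) \<le> ?w" by blast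
  have cont: "continuous_on UNIV \<phi>"
  proof (rule lipschitz_on_continuous_on, rule lipschitz_onI)
    show "dist (\<phi> z) (\<phi> y) \<le> ?w * dist z y" for z y
      using p(2)[of "\<phi> z" "\<phi> y"] by (simp add: \<phi> dist_norm)
  qed (rule w0)
  have contr: "continuous_on UNIV (\<lambda>y. r' (\<phi> y))"
    by (rule C1_continuous_compose[OF r(1) cont])
  have "(\<phi> has_derivative \<phi>' y) (at y)" for y
  proof (rule has_derivative_inverse_basic[where T = UNIV])
    have "((\<lambda>x. A x + r x) has_derivative blinfun_apply (A + r' (\<phi> y))) (at (\<phi> y))"
      using C1_add[OF C1_blinfun r(1)] by (simp add: C1_def)
    then show "((\<lambda>x. A x + r x) has_derivative blinfun_apply (A + r' (\<phi> y))) (at (\<phi> y))" .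
    show "blinfun_apply (\<phi>' y) \<circ> blinfun_apply (A + r' (\<phi> y)) = id"
      unfolding blinfun_compose.rep_eq[symmetric] \<phi>'(1) by (rule ext) simp
    show "continuous (at y) \<phi>" using cont by (simp add: continuous_on_eq_continuous_at)
  qed (simp_all add: \<phi> blinfun.bounded_linear_right)
  moreover have "continuous_on UNIV \<phi>'"
  proof -
    have "(\<phi>' \<longlongrightarrow> \<phi>' y) (at y)" for y
    proof (rule LIM_zero_cancel, rule Lim_null_comparison)
      show "\<forall>\<^sub>F z in at y. norm (\<phi>' z - \<phi>' y) \<le> ?w * (norm ((A + r' (\<phi> z)) - (A + r' (\<phi> y))) * ?w)"
        by (intro always_eventually allI norm_inverse_diff_le[OF \<phi>'(1,2)] \<phi>'(3) order_refl)
      have "((\<lambda>z. r' (\<phi> z)) \<longlongrightarrow> r' (\<phi> y)) (at y)"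
        using contr by (simp add: continuous_on_eq_continuous_at isCont_def)
      then have "((\<lambda>z. ?w * (norm ((A + r' (\<phi> z)) - (A + r' (\<phi> y))) * ?w))
          \<longlongrightarrow> ?w * (norm ((A + r' (\<phi> y)) - (A + r' (\<phi> y))) * ?w)) (at y)"
        by (intro tendsto_intros)
      then show "((\<lambda>z. ?w * (norm ((A + r' (\<phi> z)) - (A + r' (\<phi> y))) * ?w)) \<longlongrightarrow> 0) (at y)" by simp
    qed
    then show ?thesis by (simp add: continuous_on_eq_continuous_at isCont_def)
  qed
  ultimately show ?thesis
    unfolding C1_def by (intro exI[of _ \<phi>'] conjI allI \<phi>') simp_all
qed

section \<open>Twice differentiable maps\<close>

lemma bdd_above_norm_iff: "bdd_above (range (\<lambda>y. norm (f y))) \<longleftrightarrow> (\<exists>M. \<forall>y. norm (f y) \<le> M)"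
  by (auto simp: bdd_above_def)

lemma SUP_norm_le_iff:
  fixes f :: "'a \<Rightarrow> 'b::real_normed_vector"
  assumes "\<exists>M. \<forall>y. norm (f y) \<le> M"
  shows "(SUP y. norm (f y)) \<le> N \<longleftrightarrow> (\<forall>y. norm (f y) \<le> N)"
  using assms by (subst cSUP_le_iff) (auto simp: bdd_above_def)

text \<open>What the definition of Gamma_1 demands of one component of \<Lambda>, with
  \<open>L\<close> bounding the first and \<open>M\<close> the second derivative. The same predicate
  describes g and k_c.\<close>

definition jet :: "('a::real_normed_vector \<Rightarrow> 'b::real_normed_vector) \<Rightarrow> ('a \<Rightarrow> 'a \<Rightarrow>\<^sub>L 'b) \<Rightarrow> real \<Rightarrow> real \<Rightarrow> bool"
  where "jet f f' L M \<longleftrightarrow> C1 f f' \<and> f 0 = 0 \<and> f' 0 = 0 \<and> (\<forall>y. norm (f' y) \<le> L) \<and> C1b f' M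
    \<and> (\<exists>N. \<forall>y. norm (f y) \<le> N)"

lemma jetD:
  assumes "jet f f' L M"
  shows "C1 f f'" "f 0 = 0" "f' 0 = 0" "norm (f' y) \<le> L" "C1b f' M" "\<exists>N. \<forall>y. norm (f y) \<le> N" "C1b f L"
  using assms by (auto simp: jet_def C1b_def)

lemma jet_iff_Cb:
  fixes f :: "'a::real_normed_vector \<Rightarrow> 'b::real_normed_vector"
  shows "(\<exists>f'. jet f f' L M) \<longleftrightarrow> Cb 2 f \<and> f 0 = 0 \<and> (f has_derivative (\<lambda>h. 0)) (at 0)
     \<and> Dsup 1 f \<le> L \<and> Dsup 2 f \<le> M" (is "?J \<longleftrightarrow> ?R")
proof
  assume ?J
  then obtain f' where j: "C1 f f'" "f 0 = 0" "f' 0 = 0" "\<And>y. norm (f' y) \<le> L" "C1b f' M" "\<exists>N. \<forall>y. norm (f y) \<le> N"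
    unfolding jet_def by blast
  then obtain f'' where f'': "C1 f' f''" "\<And>y. norm (f'' y) \<le> M" by (auto simp: C1b_def)
  have bdd: "\<exists>M. \<forall>y. norm (f' y) \<le> M" "\<exists>M. \<forall>y. norm (f'' y) \<le> M"
    using j(4) f''(2) by blast+
  have Cb: "Cb 2 f" unfolding numeral_2_eq_2 Cb_2_iff bdd_above_norm_iff
    using j(1,6) f''(1) bdd by blast
  moreover have "(f has_derivative blinfun_apply (f' 0)) (at 0)" using j(1) by (simp add: C1_def)
  moreover have "Dsup 1 f \<le> L" "Dsup 2 f \<le> M"
    using j(4) f''(2)
    by (simp_all add: numeral_2_eq_2 Dsup_1[OF j(1)] Dsup_2[OF j(1) f''(1)] SUP_norm_le_iff[OF bdd(1)] SUP_norm_le_iff[OF bdd(2)])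
  ultimately show ?R using j(2,3) by (simp add: zero_blinfun.rep_eq)
next
  assume R: ?R
  then obtain f' f'' where f: "C1 f f'" "C1 f' f''" and bdd: "\<exists>M. \<forall>y. norm (f y) \<le> M" 
      "\<exists>M. \<forall>y. norm (f' y) \<le> M" "\<exists>M. \<forall>y. norm (f'' y) \<le> M"
    unfolding numeral_2_eq_2 Cb_2_iff bdd_above_norm_iff by blast
  have "(f has_derivative blinfun_apply (f' 0)) (at 0)" using f(1) by (simp add: C1_def)
  then have "blinfun_apply (f' 0) = (\<lambda>h. 0)" using R has_derivative_unique by blast
  then have "f' 0 = 0" by (intro blinfun_eqI) (simp add: zero_blinfun.rep_eq)
  moreover have "\<forall>y. norm (f' y) \<le> L" "\<forall>y. norm (f'' y) \<le> M"
    using R by (simp_all add: numeral_2_eq_2 Dsup_1[OF f(1)] Dsup_2[OF f] SUP_norm_le_iff[OF bdd(2)] SUP_norm_le_iff[OF bdd(3)])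
  ultimately have "jet f f' L M"
    using R f bdd(1) unfolding jet_def C1b_def by blast
  then show ?J by blast
qed

lemma Cb_2_imp_C1:
  assumes "Cb 2 f"
  obtains f' L M where "C1 f f'" "\<And>y. norm (f' y) \<le> L" "C1b f' M" "\<exists>N. \<forall>y. norm (f y) \<le> N"
proof -
  obtain f' f'' where f: "C1 f f'" "C1 f' f''" and bdd: "\<exists>M. \<forall>y. norm (f y) \<le> M" 
      "\<exists>M. \<forall>y. norm (f' y) \<le> M" "\<exists>M. \<forall>y. norm (f'' y) \<le> M"
    using assms unfolding numeral_2_eq_2 Cb_2_iff bdd_above_norm_iff by blast
  then show ?thesis using that unfolding C1b_def by blast
qed

lemma Cb_2_blinfun_comp:
  assumes "Cb 2 f"
  shows "Cb 2 (\<lambda>x. blinfun_apply P (f x))"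
proof -
  obtain f' L M where f: "C1 f f'" "\<And>y. norm (f' y) \<le> L" "C1b f' M" "\<exists>N. \<forall>y. norm (f y) \<le> N"
    using Cb_2_imp_C1[OF assms] by metis
  obtain h'' where h: "C1 (\<lambda>x. P o\<^sub>L f' x) h''" "\<And>y. norm (h'' y) \<le> norm P * M"
    using C1b_blinfun_compose_const[OF f(3)] unfolding C1b_def by blast
  obtain N where N: "\<And>y. norm (f y) \<le> N" using f(4) by blast
  have "norm (P (f y)) \<le> norm P * N" for y by (intro norm_apply_le N order_refl)
  moreover have "norm (P o\<^sub>L f' y) \<le> norm P * L" for y by (intro norm_compose_le f order_refl)
  ultimately show ?thesis
    unfolding numeral_2_eq_2 Cb_2_iff bdd_above_norm_iff
    using C1_blinfun_comp[OF f(1)] h by blast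
qed

lemma Cnorm_1:
  assumes "C1 f f'" "\<exists>M. \<forall>y. norm (f y) \<le> M" "\<exists>M. \<forall>y. norm (f' y) \<le> M"
  shows "Cnorm 1 f \<le> N \<longleftrightarrow> (\<forall>y. norm (f y) \<le> N) \<and> (\<forall>y. norm (f' y) \<le> N)"
proof -
  have "{..Suc 0} = {0, Suc 0}" by auto
  then show ?thesis
    by (simp add: Cnorm_def Dsup_0[OF C1_continuous_on[OF assms(1)]] Dsup_1[OF assms(1)]
      SUP_norm_le_iff[OF assms(2)] SUP_norm_le_iff[OF assms(3)])
qed

section \<open>The splitting of the space\<close>

locale splitting =
  fixes pc :: "'x::banach \<Rightarrow> 'c::banach" and pu :: "'x \<Rightarrow> 'u::banach" and ps :: "'x \<Rightarrow> 's::banach"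
    and jc :: "'c \<Rightarrow> 'x" and ju :: "'u \<Rightarrow> 'x" and js :: "'s \<Rightarrow> 'x"
  assumes lin: "bounded_linear pc" "bounded_linear pu" "bounded_linear ps"
      "bounded_linear jc" "bounded_linear ju" "bounded_linear js"
    and proj_c: "\<And>a. pc (jc a) = a" "\<And>a. pu (jc a) = 0" "\<And>a. ps (jc a) = 0"
    and proj_u: "\<And>a. pc (ju a) = 0" "\<And>a. pu (ju a) = a" "\<And>a. ps (ju a) = 0"
    and proj_s: "\<And>a. pc (js a) = 0" "\<And>a. pu (js a) = 0" "\<And>a. ps (js a) = a"
    and maxnorm: "\<And>x. norm x = max (norm (pc x)) (max (norm (pu x)) (norm (ps x)))"
begin

definition Pc where "Pc = Blinfun pc"
definition Pu where "Pu = Blinfun pu"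
definition Ps where "Ps = Blinfun ps"
definition Jc where "Jc = Blinfun jc"
definition Ju where "Ju = Blinfun ju"
definition Js where "Js = Blinfun js"

lemma linear_zeros: "pc 0 = 0" "pu 0 = 0" "ps 0 = 0" "jc 0 = 0" "ju 0 = 0" "js 0 = 0"
  by (simp_all add: linear_0 bounded_linear.linear lin)

lemma apply_PJ [simp]:
  "blinfun_apply Pc = pc" "blinfun_apply Pu = pu" "blinfun_apply Ps = ps"
  "blinfun_apply Jc = jc" "blinfun_apply Ju = ju" "blinfun_apply Js = js"
  unfolding Pc_def Pu_def Ps_def Jc_def Ju_def Js_def
  by (simp_all add: bounded_linear_Blinfun_apply lin)

lemma glue_components [simp]:
  "pc (jc a + ju b + js c) = a" "pu (jc a + ju b + js c) = b" "ps (jc a + ju b + js c) = c"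
  using lin(1-3) by (simp_all add: linear_simps(1) proj_c proj_u proj_s)

lemma norm_glue: "norm (jc a + ju b + js c) = max (norm a) (max (norm b) (norm c))"
  by (subst maxnorm) simp

lemma norm_glue_compose:
  "norm ((Jc o\<^sub>L A) + (Ju o\<^sub>L B) + (Js o\<^sub>L C)) \<le> max (norm A) (max (norm B) (norm C))"
proof (rule norm_blinfun_bound)
  fix h
  have "norm (((Jc o\<^sub>L A) + (Ju o\<^sub>L B) + (Js o\<^sub>L C)) h) = max (norm (A h)) (max (norm (B h)) (norm (C h)))"
    by (simp add: blinfun.add_left norm_glue)
  also have "\<dots> \<le> max (norm A) (max (norm B) (norm C)) * norm h"
    by (intro max.boundedI order_trans[OF norm_blinfun] mult_right_mono) auto
  finally show "norm (((Jc o\<^sub>L A) + (Ju o\<^sub>L B) + (Js o\<^sub>L C)) h) \<le> max (norm A) (max (norm B) (norm C)) * norm h" .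
qed (simp add: le_max_iff_disj)

lemma norm_P: "norm Pc \<le> 1" "norm Pu \<le> 1" "norm Ps \<le> 1"
  using maxnorm by (auto intro!: norm_blinfun_bound)

lemma norm_P_compose: "norm (Pc o\<^sub>L A) \<le> norm A" "norm (Pu o\<^sub>L A) \<le> norm A" "norm (Ps o\<^sub>L A) \<le> norm A"
  using norm_compose_le[OF norm_P(1) order_refl, of A] norm_compose_le[OF norm_P(2) order_refl, of A]
    norm_compose_le[OF norm_P(3) order_refl, of A] by simp_all

lemma norm_p: "norm (pc x) \<le> norm x" "norm (pu x) \<le> norm x" "norm (ps x) \<le> norm x"
  using maxnorm[of x] by simp_all

lemma C1_glue:
  assumes "C1 f1 f1'" "C1 f2 f2'" "C1 f3 f3'"
  shows "C1 (\<lambda>x. jc (f1 x) + ju (f2 x) + js (f3 x)) (\<lambda>x. (Jc o\<^sub>L f1' x) + (Ju o\<^sub>L f2' x) + (Js o\<^sub>L f3' x))"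
proof -
  have "C1 (\<lambda>x. blinfun_apply Jc (f1 x) + blinfun_apply Ju (f2 x) + blinfun_apply Js (f3 x))
     (\<lambda>x. (Jc o\<^sub>L f1' x) + (Ju o\<^sub>L f2' x) + (Js o\<^sub>L f3' x))"
    by (intro C1_add C1_blinfun_comp assms)
  then show ?thesis by simp
qed

lemma C1b_glue_compose:
  assumes "C1b f1' M" "C1b f2' M" "C1b f3' M"
  shows "C1b (\<lambda>x. (Jc o\<^sub>L f1' x) + (Ju o\<^sub>L f2' x) + (Js o\<^sub>L f3' x)) M"
  by (intro C1b_glue bounded_bilinear.bounded_linear_right[OF bounded_bilinear_blinfun_compose]
      norm_glue_compose assms)

lemma C1b_P_compose:
  assumes "C1b f' M"
  shows "C1b (\<lambda>x. Pc o\<^sub>L f' x) M" "C1b (\<lambda>x. Pu o\<^sub>L f' x) M" "C1b (\<lambda>x. Ps o\<^sub>L f' x) M"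
  using norm_P C1b_nonneg[OF assms]
  by (auto intro!: C1b_mono[OF C1b_blinfun_compose_const[OF assms]] mult_left_le_one_le)

text \<open>Smoothness is imposed on the glued map into X, the derivative bounds on the components.
  Composition with the bounded projections passes from the glued map to the components, and gluing
  leads back.\<close>

lemma Gamma1_iff:
  "(r, ku, ks) \<in> Gamma1 jc ju js Lr Lu Ls \<delta> \<longleftrightarrow>
     (\<exists>r' ku' ks'. jet r r' Lr \<delta> \<and> jet ku ku' Lu \<delta> \<and> jet ks ks' Ls \<delta>)" (is "?G \<longleftrightarrow> ?J")
proof
  assume G: ?G
  let ?e = "\<lambda>y. jc (r y) + ju (ku y) + js (ks y)"
  have e: "Cb 2 ?e" "?e 0 = 0" "(?e has_derivative (\<lambda>h. 0)) (at 0)"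
    using G by (simp_all add: Gamma1_def Gamma0_def emb_def)
  have Cb: "Cb 2 r" "Cb 2 ku" "Cb 2 ks"
    using Cb_2_blinfun_comp[OF e(1), of Pc] Cb_2_blinfun_comp[OF e(1), of Pu] Cb_2_blinfun_comp[OF e(1), of Ps]
    by simp_all
  have z: "r 0 = 0" "ku 0 = 0" "ks 0 = 0"
    using glue_components[of "r 0" "ku 0" "ks 0"] unfolding e(2) linear_zeros by simp_all
  have d: "(r has_derivative (\<lambda>h. 0)) (at 0)" "(ku has_derivative (\<lambda>h. 0)) (at 0)"
     "(ks has_derivative (\<lambda>h. 0)) (at 0)"
    using bounded_linear.has_derivative[OF lin(1) e(3)] bounded_linear.has_derivative[OF lin(2) e(3)]
      bounded_linear.has_derivative[OF lin(3) e(3)]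
    by (simp_all add: linear_zeros)
  have "\<exists>r'. jet r r' Lr \<delta>" "\<exists>ku'. jet ku ku' Lu \<delta>" "\<exists>ks'. jet ks ks' Ls \<delta>"
    unfolding jet_iff_Cb using Cb z d G by (simp_all add: Gamma1_def Gamma0_def)
  then show ?J by blast
next
  assume ?J
  then obtain r' ku' ks' where j: "jet r r' Lr \<delta>" "jet ku ku' Lu \<delta>" "jet ks ks' Ls \<delta>" by blast
  let ?e = "\<lambda>y. jc (r y) + ju (ku y) + js (ks y)"
  let ?e' = "\<lambda>x. (Jc o\<^sub>L r' x) + (Ju o\<^sub>L ku' x) + (Js o\<^sub>L ks' x)"
  \<comment> \<open>This coarse first-derivative bound only gives access to
    \<open>jet_iff_Cb\<close>; the separate bounds on the components are recovered below.\<close>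
  have "jet ?e ?e' (max Lr (max Lu Ls)) \<delta>"
    unfolding jet_def
  proof (intro conjI allI)
    show "C1 ?e ?e'" using j by (intro C1_glue) (auto dest: jetD)
    show "?e 0 = 0" using jetD(2)[OF j(1)] jetD(2)[OF j(2)] jetD(2)[OF j(3)] by (simp add: linear_zeros)
    show "?e' 0 = 0" using jetD(3)[OF j(1)] jetD(3)[OF j(2)] jetD(3)[OF j(3)]
      by (intro blinfun_eqI) (simp add: linear_zeros blinfun.add_left)
    show "norm (?e' y) \<le> max Lr (max Lu Ls)" for y
      by (rule order_trans[OF norm_glue_compose]) (intro max.mono jetD(4)[OF j(1)] jetD(4)[OF j(2)] jetD(4)[OF j(3)])
    show "C1b ?e' \<delta>" by (intro C1b_glue_compose jetD(5)[OF j(1)] jetD(5)[OF j(2)] jetD(5)[OF j(3)])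
    obtain N1 N2 N3 where "\<And>y. norm (r y) \<le> N1" "\<And>y. norm (ku y) \<le> N2" "\<And>y. norm (ks y) \<le> N3"
      using jetD(6)[OF j(1)] jetD(6)[OF j(2)] jetD(6)[OF j(3)] by blast
    then have "norm (?e y) \<le> max N1 (max N2 N3)" for y unfolding norm_glue by (intro max.mono)
    then show "\<exists>N. \<forall>y. norm (?e y) \<le> N" by blast
  qed
  then have "Cb 2 ?e \<and> ?e 0 = 0 \<and> (?e has_derivative (\<lambda>h. 0)) (at 0)
     \<and> Dsup 1 ?e \<le> max Lr (max Lu Ls) \<and> Dsup 2 ?e \<le> \<delta>"
    by (intro iffD1[OF jet_iff_Cb] exI)
  then have e: "Cb 2 ?e" "?e 0 = 0" "(?e has_derivative (\<lambda>h. 0)) (at 0)" by simp_all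
  have "Cb 1 ?e" using Cb_mono[OF e(1)] by simp
  moreover have "Dsup 1 r \<le> Lr" "Dsup 2 r \<le> \<delta>" "Dsup 1 ku \<le> Lu" "Dsup 2 ku \<le> \<delta>" "Dsup 1 ks \<le> Ls" "Dsup 2 ks \<le> \<delta>"
    using iffD1[OF jet_iff_Cb exI, OF j(1)] iffD1[OF jet_iff_Cb exI, OF j(2)] iffD1[OF jet_iff_Cb exI, OF j(3)]
    by simp_all
  ultimately show ?G using e by (simp add: Gamma1_def Gamma0_def emb_def)
qed

text \<open>The maximum norm splits the C1 distance into six suprema. Upper bounds come from gluing,
  lower bounds from projections of norm at most one. Both directions are used: one to bound the
  distance of the images, the other to exploit the distance of the arguments.\<close>

lemma Cnorm_diff_le_iff:
  assumes "jet r r' Lr \<delta>" "jet ku ku' Lu \<delta>" "jet ks ks' Ls \<delta>"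
    and "jet r2 r2' Lr \<delta>" "jet ku2 ku2' Lu \<delta>" "jet ks2 ks2' Ls \<delta>"
  shows "Cnorm 1 (\<lambda>y. emb jc ju js (r, ku, ks) y - emb jc ju js (r2, ku2, ks2) y) \<le> N \<longleftrightarrow>
    (\<forall>y. norm (r y - r2 y) \<le> N \<and> norm (ku y - ku2 y) \<le> N \<and> norm (ks y - ks2 y) \<le> N
      \<and> norm (r' y - r2' y) \<le> N \<and> norm (ku' y - ku2' y) \<le> N \<and> norm (ks' y - ks2' y) \<le> N)"
proof -
  let ?f = "\<lambda>y. emb jc ju js (r, ku, ks) y - emb jc ju js (r2, ku2, ks2) y"
  have fy: "?f y = jc (r y - r2 y) + ju (ku y - ku2 y) + js (ks y - ks2 y)" for y
    by (simp add: emb_def lin[THEN bounded_linear.linear, THEN linear_diff] algebra_simps)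
  let ?f' = "\<lambda>y. (Jc o\<^sub>L (r' y - r2' y)) + (Ju o\<^sub>L (ku' y - ku2' y)) + (Js o\<^sub>L (ks' y - ks2' y))"
  have C1: "C1 ?f ?f'" unfolding fy by (intro C1_glue C1_diff assms[THEN jetD(1)])
  obtain N1 N2 N3 N4 N5 N6 where N: "\<And>y. norm (r y) \<le> N1" "\<And>y. norm (ku y) \<le> N2" "\<And>y. norm (ks y) \<le> N3"
    "\<And>y. norm (r2 y) \<le> N4" "\<And>y. norm (ku2 y) \<le> N5" "\<And>y. norm (ks2 y) \<le> N6"
    using assms[THEN jetD(6)] by metis
  have "norm (?f y) \<le> max (N1 + N4) (max (N2 + N5) (N3 + N6))" for y
    unfolding fy norm_glue by (intro max.mono order_trans[OF norm_triangle_ineq4] add_mono N)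
  then have b: "\<exists>M. \<forall>y. norm (?f y) \<le> M" by blast
  have "norm (?f' y) \<le> max (Lr + Lr) (max (Lu + Lu) (Ls + Ls))" for y
    by (rule order_trans[OF norm_glue_compose])
       (intro max.mono order_trans[OF norm_triangle_ineq4] add_mono assms[THEN jetD(4)])
  then have b': "\<exists>M. \<forall>y. norm (?f' y) \<le> M" by blast
  have "norm (?f' y) = max (norm (r' y - r2' y)) (max (norm (ku' y - ku2' y)) (norm (ks' y - ks2' y)))" for y
  proof (rule antisym)
    have "r' y - r2' y = Pc o\<^sub>L ?f' y" "ku' y - ku2' y = Pu o\<^sub>L ?f' y" "ks' y - ks2' y = Ps o\<^sub>L ?f' y"
      by (intro blinfun_eqI; simp add: blinfun.add_left)+
    then show "max (norm (r' y - r2' y)) (max (norm (ku' y - ku2' y)) (norm (ks' y - ks2' y))) \<le> norm (?f' y)"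
      using norm_P_compose[of "?f' y"] by simp
  qed (rule norm_glue_compose)
  then show ?thesis
    unfolding Cnorm_1[OF C1 b b'] by (auto simp: fy norm_glue)
qed

end

section \<open>Invariance\<close>

text \<open>Adding L_t to \<open>ai\<close> closes the geometric series, which gives exactly the
  Lipschitz constant of the inverse in \<open>perturbed_iso_bij\<close>.\<close>

lemma L_m1_eq:
  assumes "L_r Lg Lc a * ai < 1"
  shows "L_m1 Lg Lc a ai = ai / (1 - L_r Lg Lc a * ai)"
  using assms by (simp add: L_m1_def L_t_def field_simps power2_eq_square)

text \<open>The three identities are the definitions of L_r, L_u, L_s with denominators cleared,
  written in the shape in which the derivative estimates produce them.\<close>

lemma S_cond_consts:
  assumes S: "S_cond 2 Lg Lc a ai ui s" and nn: "0 \<le> Lg" "0 \<le> Lc" "0 \<le> a" "0 \<le> ai" "0 \<le> ui" "0 \<le> s"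
  defines "Lr \<equiv> L_r Lg Lc a" and "Lu \<equiv> L_u Lg Lc a ui" and "Ls \<equiv> L_s Lg Lc a ai s" and "Lm \<equiv> L_m1 Lg Lc a ai"
  shows "0 \<le> Lr" "0 \<le> Lu" "0 \<le> Ls" "0 \<le> Lm" "Lr * ai < 1" "Lm = ai / (1 - Lr * ai)"
    and "a * Lc + Lg * (1 + Lc) + Lc * (a + Lr) = Lr"
    and "ui * (Lu * (a + Lr)) + ui * (Lg * (1 + Lc)) = Lu"
    and "s * (Ls * Lm) + Lg * (1 + Lc) * Lm = Ls"
    and "Lu \<le> 1 + Lc" "Ls \<le> 1 + Lc"
proof -
  have c: "Lc < 1" "Lr * ai < 1" "Lr * ui + a * ui < 1" "Lr * ai + s * ai < 1"
    and th: "theta2 1 Lg Lc a ui < 1" "theta3 1 Lg Lc a ai s < 1"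
    using S by (auto simp: S_cond_def Lr_def)
  show "Lr * ai < 1" by (rule c)
  show Lr0: "0 \<le> Lr" unfolding Lr_def L_r_def using nn c(1) by simp
  show Lu0: "0 \<le> Lu" unfolding Lu_def L_u_def using nn c(3)[unfolded Lr_def]
    by (intro divide_nonneg_nonneg mult_nonneg_nonneg) auto
  show Ls0: "0 \<le> Ls" unfolding Ls_def L_s_def using nn c(4)[unfolded Lr_def]
    by (intro divide_nonneg_nonneg mult_nonneg_nonneg) auto
  show Lm: "Lm = ai / (1 - Lr * ai)" unfolding Lm_def Lr_def by (rule L_m1_eq[OF c(2)[unfolded Lr_def]])
  then show Lm0: "0 \<le> Lm" using nn c(2) by simp
  have Lm': "Lm * (1 - Lr * ai) = ai" using c(2) by (simp add: Lm)
  have Lr': "Lr * (1 - Lc) = Lg + Lc * (2 * a + Lg)" using c(1) by (simp add: Lr_def L_r_def)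
  then show "a * Lc + Lg * (1 + Lc) + Lc * (a + Lr) = Lr" by (simp add: algebra_simps)
  have Lu': "Lu * (1 - Lr * ui - a * ui) = ui * (1 + Lc) * Lg"
    using c(3) by (simp add: Lu_def L_u_def Lr_def)
  then show "ui * (Lu * (a + Lr)) + ui * (Lg * (1 + Lc)) = Lu" by (simp add: algebra_simps)
  have Ls': "Ls * (1 - Lr * ai - s * ai) = ai * (1 + Lc) * Lg"
    using c(4) by (simp add: Ls_def L_s_def Lr_def)
  \<comment> \<open>Multiplication by the positive number \<open>1 - Lr * ai\<close> turns
    \<open>Lm\<close> into \<open>ai\<close>, after which the definition of L_s applies.\<close>
  have "(s * (Ls * Lm) + Lg * (1 + Lc) * Lm) * (1 - Lr * ai) = (s * Ls + Lg * (1 + Lc)) * (Lm * (1 - Lr * ai))"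
    by (simp add: algebra_simps)
  also have "\<dots> = Ls * (1 - Lr * ai)" unfolding Lm' using Ls' by (simp add: algebra_simps)
  finally show "s * (Ls * Lm) + Lg * (1 + Lc) * Lm = Ls" using c(2) by simp
  \<comment> \<open>This is \<theta>_{1,2} < 1 with the nonnegative term \<open>ui * Lu\<close>
    dropped. It makes the quotient in L_u at most \<open>1 + Lc\<close>.\<close>
  have "ui * Lg \<le> 1 - Lr * ui - a * ui"
  proof -
    have "0 \<le> ui * Lu" using nn Lu0 by simp
    then show ?thesis using th(1) by (simp add: theta2_def flip: Lr_def Lu_def) (simp add: algebra_simps)
  qed
  then have "Lu * (1 - Lr * ui - a * ui) \<le> (1 + Lc) * (1 - Lr * ui - a * ui)"
    unfolding Lu' using mult_left_mono[of "ui * Lg" _ "1 + Lc"] nn by (simp add: mult_ac)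
  then show "Lu \<le> 1 + Lc" using c(3) by (simp add: mult_le_cancel_right)
  \<comment> \<open>Here \<theta>_{1,3} < 1 is weakened to \<open>Lm * (s + Lg) < 1\<close>, then
    multiplied by \<open>1 - Lr * ai\<close>.\<close>
  have "ai * Lg \<le> 1 - Lr * ai - s * ai"
  proof -
    have "Lm * (s + Lg) \<le> Lm * (s * (1 + Lm * Ls) + Lg * (1 + Lm * (1 + Lc)))"
      using nn Lm0 Ls0 by (intro mult_left_mono add_mono mult_le_cancel_left1[THEN iffD2]) (auto simp: algebra_simps)
    also have "\<dots> < 1" using th(2) by (simp add: theta3_def flip: Lm_def Ls_def)
    finally have "Lm * (s + Lg) * (1 - Lr * ai) \<le> 1 * (1 - Lr * ai)"
      using c(2) by (intro mult_right_mono) auto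
    moreover have "Lm * (s + Lg) * (1 - Lr * ai) = (s + Lg) * (Lm * (1 - Lr * ai))" by (simp add: mult_ac)
    ultimately show ?thesis unfolding Lm' by (simp add: algebra_simps)
  qed
  then have "Ls * (1 - Lr * ai - s * ai) \<le> (1 + Lc) * (1 - Lr * ai - s * ai)"
    unfolding Ls' using mult_left_mono[of "ai * Lg" _ "1 + Lc"] nn by (simp add: mult_ac)
  then show "Ls \<le> 1 + Lc" using c(4) by (simp add: mult_le_cancel_right)
qed

locale graph_transform = splitting pc pu ps jc ju js
  for pc :: "'x::banach \<Rightarrow> 'c::banach" and pu :: "'x \<Rightarrow> 'u::banach" and ps :: "'x \<Rightarrow> 's::banach"
    and jc :: "'c \<Rightarrow> 'x" and ju :: "'u \<Rightarrow> 'x" and js :: "'s \<Rightarrow> 'x" +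
  fixes Lg Lc :: real and Ac Aci :: "'c \<Rightarrow>\<^sub>L 'c" and Aui :: "'u \<Rightarrow>\<^sub>L 'u" and As :: "'s \<Rightarrow>\<^sub>L 's"
    and g :: "'x \<Rightarrow> 'x" and g' and kc :: "'c \<Rightarrow> 'c" and kc' and \<epsilon> :: real
  assumes inv_c: "Ac o\<^sub>L Aci = id_blinfun" "Aci o\<^sub>L Ac = id_blinfun"
    and Lg0: "0 \<le> Lg" and Lc0: "0 \<le> Lc"
    and S2: "S_cond 2 Lg Lc (norm Ac) (norm Aci) (norm Aui) (norm As)"
    and g: "jet g g' Lg \<epsilon>" and kc: "jet kc kc' Lc \<epsilon>"
begin

abbreviation "Lr \<equiv> L_r Lg Lc (norm Ac)"
abbreviation "Lu \<equiv> L_u Lg Lc (norm Ac) (norm Aui)"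
abbreviation "Ls \<equiv> L_s Lg Lc (norm Ac) (norm Aci) (norm As)"
abbreviation "Lm \<equiv> L_m1 Lg Lc (norm Ac) (norm Aci)"

lemmas rate_facts = S_cond_consts[OF S2 Lg0 Lc0 norm_ge_zero norm_ge_zero norm_ge_zero norm_ge_zero]

end

section \<open>The maps entering \<Theta> for a single argument, and invariance\<close>

locale graph_transform_arg = graph_transform pc pu ps jc ju js Lg Lc Ac Aci Aui As g g' kc kc' \<epsilon>
  for pc :: "'x::banach \<Rightarrow> 'c::banach" and pu :: "'x \<Rightarrow> 'u::banach" and ps :: "'x \<Rightarrow> 's::banach"
    and jc ju js Lg Lc Ac Aci Aui As g g' kc kc' \<epsilon> +
  fixes \<delta> and r :: "'c \<Rightarrow> 'c" and ku :: "'c \<Rightarrow> 'u" and ks :: "'c \<Rightarrow> 's" and r' ku' ks'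
  assumes r: "jet r r' Lr \<delta>" and ku: "jet ku ku' Lu \<delta>" and ks: "jet ks ks' Ls \<delta>"
begin

definition "K x = jc (x + kc x) + ju (ku x) + js (ks x)"
definition "K' x = (Jc o\<^sub>L (id_blinfun + kc' x)) + (Ju o\<^sub>L ku' x) + (Js o\<^sub>L ks' x)"
definition "G x = g (K x)"
definition "G' x = g' (K x) o\<^sub>L K' x"
definition "Ar x = Ac x + r x"
definition "Ar' x = Ac + r' x"
definition "\<phi> = inv Ar"
text \<open>Choosing the field once fixes a name for the derivative of the inverse;
  \<open>perturbed_iso_C1_inverse\<close> shows that the choice is not vacuous.\<close>

definition "\<phi>' = (SOME \<phi>'. C1 \<phi> \<phi>' \<and> (\<forall>y. \<phi>' y o\<^sub>L Ar' (\<phi> y) = id_blinfun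
    \<and> Ar' (\<phi> y) o\<^sub>L \<phi>' y = id_blinfun \<and> norm (\<phi>' y) \<le> Lm))"

definition "\<theta>r x = Ac (kc x) + pc (G x) - kc (Ar x)"
definition "\<theta>r' x = (Ac o\<^sub>L kc' x) + (Pc o\<^sub>L G' x) - (kc' (Ar x) o\<^sub>L Ar' x)"
definition "\<theta>u x = Aui (ku (Ar x)) - Aui (pu (G x))"
definition "\<theta>u' x = (Aui o\<^sub>L (ku' (Ar x) o\<^sub>L Ar' x)) - (Aui o\<^sub>L (Pu o\<^sub>L G' x))"
definition "\<theta>s x = As (ks (\<phi> x)) + ps (G (\<phi> x))"
definition "\<theta>s' x = (As o\<^sub>L (ks' (\<phi> x) o\<^sub>L \<phi>' x)) + (Ps o\<^sub>L (G' (\<phi> x) o\<^sub>L \<phi>' x))"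

lemma Theta_eq: "Theta Ac Aui As jc ju js (pc \<circ> g) (pu \<circ> g) (ps \<circ> g) kc (r, ku, ks) = (\<theta>r, \<theta>u, \<theta>s)"
  by (simp add: Theta_def Let_def fun_eq_iff \<theta>r_def \<theta>u_def \<theta>s_def G_def K_def[abs_def] \<phi>_def Ar_def[abs_def])

lemma K_C1: "C1 K K'"
  unfolding K_def[abs_def] K'_def[abs_def]
  by (intro C1_glue C1_add C1_id jetD(1)[OF kc] jetD(1)[OF ku] jetD(1)[OF ks])

text \<open>The center block contributes \<open>1 + Lc\<close>. The other two blocks stay below it
  because L_u and L_s are at most \<open>1 + Lc\<close>, and the maximum norm does the rest.\<close>

lemma K'_bound: "norm (K' x) \<le> 1 + Lc"
proof -
  have "norm (id_blinfun + kc' x) \<le> 1 + Lc"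
    by (intro norm_triangle_mono jetD(4)[OF kc] norm_blinfun_bound) auto
  moreover have "norm (ku' x) \<le> 1 + Lc" "norm (ks' x) \<le> 1 + Lc"
    using jetD(4)[OF ku, of x] jetD(4)[OF ks, of x] rate_facts(10,11) by linarith+
  ultimately show ?thesis
    unfolding K'_def by (intro order_trans[OF norm_glue_compose]) simp
qed

lemma K'_C1b: "C1b K' (max \<epsilon> \<delta>)"
proof -
  have "C1b (\<lambda>x. id_blinfun + kc' x) (0 + \<epsilon>)" by (intro C1b_add C1b_const jetD(5)[OF kc])
  then show ?thesis unfolding K'_def[abs_def]
    by (intro C1b_glue_compose) (auto elim!: C1b_mono intro: C1b_mono[OF jetD(5)[OF ku]] C1b_mono[OF jetD(5)[OF ks]])
qed

lemma K_C1b: "C1b K (1 + Lc)"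
  using K_C1 K'_bound by (rule C1bI)

lemma G_C1: "C1 G G'"
  unfolding G_def[abs_def] G'_def[abs_def] by (intro C1_compose jetD(1)[OF g] K_C1)

lemma G'_bound: "norm (G' x) \<le> Lg * (1 + Lc)"
  unfolding G'_def by (intro norm_compose_le jetD(4)[OF g] K'_bound)

lemma G_C1b: "C1b G (Lg * (1 + Lc))"
  using G_C1 G'_bound by (rule C1bI)

lemma G'_C1b: "C1b G' (\<epsilon> * (1 + Lc) * (1 + Lc) + Lg * max \<epsilon> \<delta>)"
  unfolding G'_def[abs_def]
  by (intro C1b_blinfun_compose C1b_compose[OF jetD(5)[OF g] K_C1b] K'_C1b jetD(4)[OF g] K'_bound)

lemma Ar_C1: "C1 Ar Ar'"
  unfolding Ar_def[abs_def] Ar'_def[abs_def] by (intro C1_add C1_blinfun jetD(1)[OF r])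

lemma Ar'_bound: "norm (Ar' x) \<le> norm Ac + Lr"
  unfolding Ar'_def by (intro norm_triangle_mono order_refl jetD(4)[OF r])

lemma Ar_C1b: "C1b Ar (norm Ac + Lr)"
  using Ar_C1 Ar'_bound by (rule C1bI)

lemma Ar'_C1b: "C1b Ar' \<delta>"
  using C1b_add[OF C1b_const jetD(5)[OF r]] unfolding Ar'_def[abs_def] by simp

lemma Ar_bij: "bij Ar"
  unfolding Ar_def[abs_def]
  using perturbed_iso_bij(1)[OF inv_c C1b_lipschitz[OF jetD(7)[OF r]] rate_facts(1,5)] .

lemma Ar_\<phi>: "Ar (\<phi> x) = x"
  unfolding \<phi>_def by (rule surj_f_inv_f[OF bij_is_surj[OF Ar_bij]])

lemma \<phi>_Ar: "\<phi> (Ar x) = x"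
  unfolding \<phi>_def by (rule inv_f_f[OF bij_is_inj[OF Ar_bij]])

lemma \<phi>'_props:
  "C1 \<phi> \<phi>'" "\<phi>' y o\<^sub>L Ar' (\<phi> y) = id_blinfun" "Ar' (\<phi> y) o\<^sub>L \<phi>' y = id_blinfun" "norm (\<phi>' y) \<le> Lm"
proof -
  have "\<exists>\<phi>'. C1 \<phi> \<phi>' \<and> (\<forall>y. \<phi>' y o\<^sub>L Ar' (\<phi> y) = id_blinfun
    \<and> Ar' (\<phi> y) o\<^sub>L \<phi>' y = id_blinfun \<and> norm (\<phi>' y) \<le> Lm)"
    unfolding \<phi>_def Ar'_def Ar_def[abs_def] rate_facts(6)
    by (rule perturbed_iso_C1_inverse[OF inv_c jetD(1)[OF r] jetD(4)[OF r] rate_facts(5)])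
  from someI_ex[OF this, folded \<phi>'_def]
  show "C1 \<phi> \<phi>'" "\<phi>' y o\<^sub>L Ar' (\<phi> y) = id_blinfun" "Ar' (\<phi> y) o\<^sub>L \<phi>' y = id_blinfun" "norm (\<phi>' y) \<le> Lm"
    by blast+
qed

lemma \<phi>_C1b: "C1b \<phi> Lm"
  using \<phi>'_props(1,4) by (rule C1bI)

lemma \<phi>'_C1b: "C1b \<phi>' (Lm * (\<delta> * Lm) * Lm)"
  by (intro C1b_inverse_operator[where B = "\<lambda>y. Ar' (\<phi> y)"] C1b_compose[OF Ar'_C1b \<phi>_C1b] \<phi>'_props)

lemma at_0: "K 0 = 0" "Ar 0 = 0" "\<phi> 0 = 0" "G 0 = 0" "G' 0 = 0"
proof -
  show K: "K 0 = 0" unfolding K_def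
    by (simp add: jetD(2)[OF kc] jetD(2)[OF ku] jetD(2)[OF ks] linear_zeros)
  show Ar: "Ar 0 = 0" by (simp add: Ar_def jetD(2)[OF r])
  show "\<phi> 0 = 0" using \<phi>_Ar[of 0] by (simp add: Ar)
  show "G 0 = 0" "G' 0 = 0" by (auto simp: G_def G'_def K jetD(2)[OF g] jetD(3)[OF g] intro!: blinfun_eqI)
qed

text \<open>The hypothesis is C_1(\<epsilon>) + \<theta>_{2,1} \<delta> \<le> \<delta> rearranged.
  In C_1 the terms \<open>a\<close> and \<open>(a + Lr)^2\<close> come from the second derivative of
  k_c, in A_c k_c and in k_c o (A_c + r); \<open>(1 + Lc)^2\<close> comes from that of g. The
  factors of \<delta> come from the second derivatives of \<open>K\<close> and of
  \<open>r\<close>.\<close>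

lemma \<theta>r_jet:
  assumes "C_1 Lg Lc (norm Ac) \<epsilon> \<le> (1 - theta1 2 Lg Lc) * \<delta>"
  shows "jet \<theta>r \<theta>r' Lr \<delta>"
  unfolding jet_def
proof (intro conjI allI)
  show "C1 \<theta>r \<theta>r'"
    using C1_diff[OF C1_add[OF C1_blinfun_comp[OF jetD(1)[OF kc], of Ac] C1_blinfun_comp[OF G_C1, of Pc]]
       C1_compose[OF jetD(1)[OF kc] Ar_C1]]
    unfolding \<theta>r_def[abs_def] \<theta>r'_def[abs_def] by simp
  show "\<theta>r 0 = 0" by (simp add: \<theta>r_def at_0 jetD(2)[OF kc] linear_zeros)
  show "\<theta>r' 0 = 0" by (intro blinfun_eqI) (simp add: \<theta>r'_def at_0 jetD(3)[OF kc] blinfun.add_left blinfun.diff_left linear_zeros)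
  show "norm (\<theta>r' x) \<le> Lr" for x
  proof -
    have "norm (\<theta>r' x) \<le> (norm Ac * Lc + Lg * (1 + Lc)) + Lc * (norm Ac + Lr)"
      unfolding \<theta>r'_def
      by (intro order_trans[OF norm_triangle_ineq4] norm_triangle_mono add_mono norm_compose_le jetD(4)[OF kc]
           Ar'_bound order_refl order_trans[OF norm_P_compose(1) G'_bound])
    then show ?thesis using rate_facts(7) by simp
  qed
  have "C1b \<theta>r' ((norm Ac * \<epsilon> + (\<epsilon> * (1 + Lc) * (1 + Lc) + Lg * max \<epsilon> \<delta>))
       + (\<epsilon> * (norm Ac + Lr) * (norm Ac + Lr) + Lc * \<delta>))"
    unfolding \<theta>r'_def[abs_def]
    by (intro C1b_diff C1b_add C1b_blinfun_compose_const jetD(5)[OF kc] C1b_P_compose G'_C1b C1b_blinfun_compose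
         C1b_compose[OF jetD(5)[OF kc] Ar_C1b] Ar'_C1b jetD(4)[OF kc] Ar'_bound)
  then show "C1b \<theta>r' \<delta>"
  proof (rule C1b_mono)
    \<comment> \<open>The maximum bounds the second derivative of \<open>K\<close>. Splitting it
      into a sum accounts for the term \<open>Lg\<close> in C_1 and for the term \<open>Lg\<close>
      in \<theta>_{2,1}.\<close>
    have "Lg * max \<epsilon> \<delta> \<le> Lg * \<epsilon> + Lg * \<delta>"
      using C1b_nonneg[OF jetD(5)[OF kc]] C1b_nonneg[OF jetD(5)[OF r]] Lg0 by (auto simp: max_def)
    then show "(norm Ac * \<epsilon> + (\<epsilon> * (1 + Lc) * (1 + Lc) + Lg * max \<epsilon> \<delta>))
       + (\<epsilon> * (norm Ac + Lr) * (norm Ac + Lr) + Lc * \<delta>) \<le> \<delta>"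
      using assms unfolding C_1_def theta1_def by (simp add: algebra_simps power2_eq_square)
  qed
  obtain N M where N: "\<And>x. norm (kc x) \<le> N" and M: "\<And>x. norm (g x) \<le> M"
    using jetD(6)[OF kc] jetD(6)[OF g] by blast
  have "norm (\<theta>r x) \<le> (norm Ac * N + M) + N" for x
    unfolding \<theta>r_def G_def
    by (intro order_trans[OF norm_triangle_ineq4] norm_triangle_mono add_mono norm_apply_le N order_refl
         order_trans[OF norm_p(1) M])
  then show "\<exists>N. \<forall>x. norm (\<theta>r x) \<le> N" by blast
qed

text \<open>The square in \<theta>_{2,2} arises from the second derivative of \<open>ku\<close> with
  \<open>Ar'\<close> inserted twice; \<open>Lu\<close> multiplies the second derivative of
  \<open>r\<close>.\<close>

lemma \<theta>u_jet:
  assumes "C_2 Lg Lc (norm Aui) \<epsilon> \<le> (1 - theta2 2 Lg Lc (norm Ac) (norm Aui)) * \<delta>"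
  shows "jet \<theta>u \<theta>u' Lu \<delta>"
  unfolding jet_def
proof (intro conjI allI)
  show "C1 \<theta>u \<theta>u'"
    using C1_diff[OF C1_blinfun_comp[OF C1_compose[OF jetD(1)[OF ku] Ar_C1], of Aui]
       C1_blinfun_comp[OF C1_blinfun_comp[OF G_C1, of Pu], of Aui]]
    unfolding \<theta>u_def[abs_def] \<theta>u'_def[abs_def] by simp
  show "\<theta>u 0 = 0" by (simp add: \<theta>u_def at_0 jetD(2)[OF ku] linear_zeros)
  show "\<theta>u' 0 = 0" by (intro blinfun_eqI) (simp add: \<theta>u'_def at_0 jetD(3)[OF ku] blinfun.add_left blinfun.diff_left linear_zeros)
  show "norm (\<theta>u' x) \<le> Lu" for x
  proof -
    have "norm (\<theta>u' x) \<le> norm Aui * (Lu * (norm Ac + Lr)) + norm Aui * (Lg * (1 + Lc))"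
      unfolding \<theta>u'_def
      by (intro order_trans[OF norm_triangle_ineq4] add_mono norm_compose_le jetD(4)[OF ku]
           Ar'_bound order_refl order_trans[OF norm_P_compose(2) G'_bound])
    then show ?thesis using rate_facts(8) by simp
  qed
  have "C1b \<theta>u' (norm Aui * (\<delta> * (norm Ac + Lr) * (norm Ac + Lr) + Lu * \<delta>)
     + norm Aui * (\<epsilon> * (1 + Lc) * (1 + Lc) + Lg * max \<epsilon> \<delta>))"
    unfolding \<theta>u'_def[abs_def]
    by (intro C1b_diff C1b_blinfun_compose_const[where A = Aui] C1b_P_compose G'_C1b C1b_blinfun_compose
         C1b_compose[OF jetD(5)[OF ku] Ar_C1b] Ar'_C1b jetD(4)[OF ku] Ar'_bound)
  then show "C1b \<theta>u' \<delta>"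
  proof (rule C1b_mono)
    have "norm Aui * (Lg * max \<epsilon> \<delta>) \<le> norm Aui * (Lg * \<epsilon> + Lg * \<delta>)"
      using C1b_nonneg[OF jetD(5)[OF kc]] C1b_nonneg[OF jetD(5)[OF r]] Lg0
      by (intro mult_left_mono) (auto simp: max_def)
    then show "norm Aui * (\<delta> * (norm Ac + Lr) * (norm Ac + Lr) + Lu * \<delta>)
     + norm Aui * (\<epsilon> * (1 + Lc) * (1 + Lc) + Lg * max \<epsilon> \<delta>) \<le> \<delta>"
      using assms unfolding C_2_def theta2_def by (simp add: algebra_simps power2_eq_square)
  qed
  obtain N M where N: "\<And>x. norm (ku x) \<le> N" and M: "\<And>x. norm (g x) \<le> M"
    using jetD(6)[OF ku] jetD(6)[OF g] by blast
  have "norm (\<theta>u x) \<le> norm Aui * N + norm Aui * M" for x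
    unfolding \<theta>u_def G_def
    by (intro order_trans[OF norm_triangle_ineq4] add_mono norm_apply_le N order_refl
         order_trans[OF norm_p(2) M])
  then show "\<exists>N. \<forall>x. norm (\<theta>u x) \<le> N" by blast
qed

text \<open>Two derivatives of the inner \<open>\<phi>\<close> give the factor \<open>Lm^2\<close>.
  The second derivative of \<open>\<phi>\<close> is bounded by \<open>Lm^3 * \<delta>\<close>, which
  explains the additional \<open>Lm\<close> beside L_s and \<open>1 + Lc\<close> in
  \<theta>_{2,3}.\<close>

lemma \<theta>s_jet:
  assumes "C_3 Lg Lc (norm Ac) (norm Aci) \<epsilon> \<le> (1 - theta3 2 Lg Lc (norm Ac) (norm Aci) (norm As)) * \<delta>"
  shows "jet \<theta>s \<theta>s' Ls \<delta>"
  unfolding jet_def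
proof (intro conjI allI)
  show "C1 \<theta>s \<theta>s'"
    using C1_add[OF C1_blinfun_comp[OF C1_compose[OF jetD(1)[OF ks] \<phi>'_props(1)], of As]
       C1_blinfun_comp[OF C1_compose[OF G_C1 \<phi>'_props(1)], of Ps]]
    unfolding \<theta>s_def[abs_def] \<theta>s'_def[abs_def] by simp
  show "\<theta>s 0 = 0" by (simp add: \<theta>s_def at_0 jetD(2)[OF ks] linear_zeros)
  show "\<theta>s' 0 = 0" by (intro blinfun_eqI) (simp add: \<theta>s'_def at_0 jetD(3)[OF ks] blinfun.add_left blinfun.diff_left linear_zeros)
  show "norm (\<theta>s' x) \<le> Ls" for x
  proof -
    have "norm (\<theta>s' x) \<le> norm As * (Ls * Lm) + Lg * (1 + Lc) * Lm"
      unfolding \<theta>s'_def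
      by (intro norm_triangle_mono norm_compose_le jetD(4)[OF ks] G'_bound
           \<phi>'_props(4) order_refl order_trans[OF norm_P_compose(3)])
    then show ?thesis using rate_facts(9) by simp
  qed
  have "C1b \<theta>s' (norm As * (\<delta> * Lm * Lm + Ls * (Lm * (\<delta> * Lm) * Lm))
     + ((\<epsilon> * (1 + Lc) * (1 + Lc) + Lg * max \<epsilon> \<delta>) * Lm * Lm + Lg * (1 + Lc) * (Lm * (\<delta> * Lm) * Lm)))"
    unfolding \<theta>s'_def[abs_def]
    by (intro C1b_add C1b_blinfun_compose_const[where A = As] C1b_P_compose C1b_blinfun_compose
         C1b_compose[OF G'_C1b \<phi>_C1b] C1b_compose[OF jetD(5)[OF ks] \<phi>_C1b] \<phi>'_C1b jetD(4)[OF ks] \<phi>'_props(4) G'_bound)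
  then show "C1b \<theta>s' \<delta>"
  proof (rule C1b_mono)
    have "Lg * max \<epsilon> \<delta> * (Lm * Lm) \<le> (Lg * \<epsilon> + Lg * \<delta>) * (Lm * Lm)"
      using C1b_nonneg[OF jetD(5)[OF kc]] C1b_nonneg[OF jetD(5)[OF r]] Lg0
      by (intro mult_right_mono) (auto simp: max_def)
    then show "norm As * (\<delta> * Lm * Lm + Ls * (Lm * (\<delta> * Lm) * Lm))
     + ((\<epsilon> * (1 + Lc) * (1 + Lc) + Lg * max \<epsilon> \<delta>) * Lm * Lm + Lg * (1 + Lc) * (Lm * (\<delta> * Lm) * Lm)) \<le> \<delta>"
      using assms unfolding C_3_def theta3_def by (simp add: algebra_simps power2_eq_square)
  qed
  obtain N M where N: "\<And>x. norm (ks x) \<le> N" and M: "\<And>x. norm (g x) \<le> M"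
    using jetD(6)[OF ks] jetD(6)[OF g] by blast
  have "norm (\<theta>s x) \<le> norm As * N + M" for x
    unfolding \<theta>s_def G_def
    by (intro norm_triangle_mono norm_apply_le N order_refl order_trans[OF norm_p(3) M])
  then show "\<exists>N. \<forall>x. norm (\<theta>s x) \<le> N" by blast
qed

end

section \<open>Contraction\<close>

text \<open>For maps that change together with their evaluation points, the intermediate value is
  the second map at the first point: the change of map costs \<open>d\<close>, the change of point a
  Lipschitz constant.\<close>

lemma norm_diff_le_via:
  "norm (x - y) \<le> M \<Longrightarrow> norm (y - z) \<le> N \<Longrightarrow> norm (x - z) \<le> M + N"
  for x y z :: "'a::real_normed_vector"
  using norm_triangle_mono[of "x - y" M "y - z" N] by simp

lemma norm_compose_diff_le:
  assumes "norm (A - A2) \<le> dA" "norm (B - B2) \<le> dB" "norm B \<le> b" "norm A2 \<le> a"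
  shows "norm ((A o\<^sub>L B) - (A2 o\<^sub>L B2)) \<le> dA * b + a * dB"
proof -
  have "(A o\<^sub>L B) - (A2 o\<^sub>L B2) = ((A - A2) o\<^sub>L B) + (A2 o\<^sub>L (B - B2))"
    by (intro blinfun_eqI) (simp add: blinfun.diff_left blinfun.diff_right blinfun.add_left)
  then show ?thesis by (simp only:) (intro norm_triangle_mono norm_compose_le assms)
qed

text \<open>Two arguments share all data of the setting. \<open>d\<close> is any common bound on the
  six differences and is later set to the C1 distance.\<close>

locale graph_transform_pair =
  A: graph_transform_arg pc pu ps jc ju js Lg Lc Ac Aci Aui As g g' kc kc' \<epsilon> \<delta> r ku ks r' ku' ks' +
  B: graph_transform_arg pc pu ps jc ju js Lg Lc Ac Aci Aui As g g' kc kc' \<epsilon> \<delta> r2 ku2 ks2 r2' ku2' ks2'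
  for pc :: "'x::banach \<Rightarrow> 'c::banach" and pu :: "'x \<Rightarrow> 'u::banach" and ps :: "'x \<Rightarrow> 's::banach"
    and jc ju js Lg Lc Ac Aci Aui As g g' kc kc' \<epsilon> \<delta> r ku ks r' ku' ks' r2 ku2 ks2 r2' ku2' ks2' +
  fixes d :: real
  assumes d: "norm (r x - r2 x) \<le> d" "norm (ku x - ku2 x) \<le> d" "norm (ks x - ks2 x) \<le> d"
    and d': "norm (r' x - r2' x) \<le> d" "norm (ku' x - ku2' x) \<le> d" "norm (ks' x - ks2' x) \<le> d"
begin

abbreviation "a \<equiv> norm Ac"
abbreviation "Lr \<equiv> A.Lr"
abbreviation "Lu \<equiv> A.Lu"
abbreviation "Ls \<equiv> A.Ls"
abbreviation "Lm \<equiv> A.Lm"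

lemma d_nonneg: "0 \<le> d"
  using d(1) norm_ge_zero order_trans by blast

text \<open>The center part \<open>x + kc x\<close> does not depend on the argument and cancels; by
  the maximum norm the other two differences cost \<open>d\<close> once.\<close>

lemma K_diff: "norm (A.K x - B.K x) \<le> d"
proof -
  have "A.K x - B.K x = jc 0 + ju (ku x - ku2 x) + js (ks x - ks2 x)"
    unfolding A.K_def B.K_def
    by (simp add: A.linear_zeros A.lin[THEN bounded_linear.linear, THEN linear_diff])
  then show ?thesis using d d_nonneg by (simp only: A.norm_glue) simp
qed

lemma K'_diff: "norm (A.K' x - B.K' x) \<le> d"
proof -
  have "A.K' x - B.K' x = (A.Jc o\<^sub>L 0) + (A.Ju o\<^sub>L (ku' x - ku2' x)) + (A.Js o\<^sub>L (ks' x - ks2' x))"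
    unfolding A.K'_def B.K'_def
    by (intro blinfun_eqI) (simp add: A.linear_zeros blinfun.diff_left blinfun.add_left
         A.lin[THEN bounded_linear.linear, THEN linear_diff])
  then show ?thesis using d' d_nonneg
    by (simp only:) (intro order_trans[OF A.norm_glue_compose], simp)
qed

lemma G_diff: "norm (A.G x - B.G x) \<le> Lg * d"
  unfolding A.G_def B.G_def
  by (rule order_trans[OF C1b_lipschitz[OF jetD(7)[OF A.g]]]) (intro mult_left_mono K_diff A.Lg0)

lemma G'_diff: "norm (A.G' x - B.G' x) \<le> (\<epsilon> * d) * (1 + Lc) + Lg * d"
  unfolding A.G'_def B.G'_def
  by (intro norm_compose_diff_le C1b_lipschitz_le[OF jetD(5)[OF A.g]] K_diff K'_diff A.K'_bound jetD(4)[OF A.g])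

lemma Ar_diff: "norm (A.Ar x - B.Ar x) \<le> d"
  using d(1) by (simp add: A.Ar_def B.Ar_def)

lemma Ar'_diff: "norm (A.Ar' x - B.Ar' x) \<le> d"
  using d'(1) by (simp add: A.Ar'_def B.Ar'_def)

text \<open>The second inverse is \<open>Lm\<close>-Lipschitz and sends \<open>B.Ar v\<close> to \<open>v\<close>, where \<open>v = A.\<phi> x\<close>, while
  \<open>B.Ar v\<close> is within \<open>d\<close> of \<open>A.Ar v = x\<close>.\<close>

lemma \<phi>_diff: "norm (A.\<phi> x - B.\<phi> x) \<le> Lm * d"
proof -
  have "norm (B.\<phi> (B.Ar (A.\<phi> x)) - B.\<phi> (A.Ar (A.\<phi> x))) \<le> Lm * d"
    by (rule C1b_lipschitz_le[OF B.\<phi>_C1b]) (subst norm_minus_commute, rule Ar_diff)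
  then show ?thesis by (simp add: A.Ar_\<phi> B.\<phi>_Ar)
qed

text \<open>By the resolvent identity it suffices to compare \<open>Ar'\<close> for the two
  arguments: \<open>d\<close> at the same point, plus \<delta> times the distance of the two
  inverses.\<close>

lemma \<phi>'_diff: "norm (A.\<phi>' x - B.\<phi>' x) \<le> Lm * ((d + \<delta> * (Lm * d)) * Lm)"
  by (intro norm_inverse_diff_le[OF A.\<phi>'_props(2) B.\<phi>'_props(3)] A.\<phi>'_props B.\<phi>'_props
       norm_diff_le_via[OF Ar'_diff] C1b_lipschitz_le[OF B.Ar'_C1b] \<phi>_diff)

text \<open>The Lipschitz constant of \<open>G'\<close> from \<open>G'_C1b\<close>; it vanishes with
  \<epsilon> and \<delta>.\<close>

definition "\<gamma> = \<epsilon> * (1 + Lc) * (1 + Lc) + Lg * max \<epsilon> \<delta>"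

lemma G\<phi>_diff: "norm (A.G (A.\<phi> x) - B.G (B.\<phi> x)) \<le> Lg * d + Lg * (1 + Lc) * (Lm * d)"
  by (intro norm_diff_le_via[OF G_diff] C1b_lipschitz_le[OF B.G_C1b] \<phi>_diff)

lemma G'\<phi>_diff:
  "norm (A.G' (A.\<phi> x) - B.G' (B.\<phi> x)) \<le> ((\<epsilon> * d) * (1 + Lc) + Lg * d) + \<gamma> * (Lm * d)"
  unfolding \<gamma>_def by (intro norm_diff_le_via[OF G'_diff] C1b_lipschitz_le[OF B.G'_C1b] \<phi>_diff)

lemma \<theta>r_diff: "norm (A.\<theta>r x - B.\<theta>r x) \<le> (Lg + Lc) * d"
proof -
  have "A.\<theta>r x - B.\<theta>r x = pc (A.G x - B.G x) - (kc (A.Ar x) - kc (B.Ar x))"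
    unfolding A.\<theta>r_def B.\<theta>r_def by (simp add: A.lin[THEN bounded_linear.linear, THEN linear_diff])
  also have "norm \<dots> \<le> Lg * d + Lc * d"
    by (intro order_trans[OF norm_triangle_ineq4] add_mono order_trans[OF A.norm_p(1) G_diff]
        C1b_lipschitz_le[OF jetD(7)[OF A.kc]] Ar_diff)
  finally show ?thesis by (simp add: algebra_simps)
qed

lemma \<theta>u_diff: "norm (A.\<theta>u x - B.\<theta>u x) \<le> (norm Aui * (1 + Lg + Lu)) * d"
proof -
  have "A.\<theta>u x - B.\<theta>u x = Aui (ku (A.Ar x) - ku2 (B.Ar x)) - Aui (pu (A.G x - B.G x))"
    unfolding A.\<theta>u_def B.\<theta>u_def by (simp add: A.lin[THEN bounded_linear.linear, THEN linear_diff] blinfun.diff_right)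
  also have "norm \<dots> \<le> norm Aui * (d + Lu * d) + norm Aui * (Lg * d)"
    by (intro order_trans[OF norm_triangle_ineq4] add_mono norm_apply_le order_refl
        order_trans[OF A.norm_p(2) G_diff] norm_diff_le_via[OF d(2)] C1b_lipschitz_le[OF jetD(7)[OF B.ku]] Ar_diff)
  finally show ?thesis by (simp add: algebra_simps)
qed

lemma \<theta>s_diff: "norm (A.\<theta>s x - B.\<theta>s x) \<le> (norm As * (1 + Lm * Ls) + Lg * (1 + Lm * (1 + Lc))) * d"
proof -
  have "A.\<theta>s x - B.\<theta>s x = As (ks (A.\<phi> x) - ks2 (B.\<phi> x)) + ps (A.G (A.\<phi> x) - B.G (B.\<phi> x))"
    unfolding A.\<theta>s_def B.\<theta>s_def by (simp add: A.lin[THEN bounded_linear.linear, THEN linear_diff] blinfun.diff_right)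
  also have "norm \<dots> \<le> norm As * (d + Ls * (Lm * d)) + (Lg * d + Lg * (1 + Lc) * (Lm * d))"
    by (intro norm_triangle_mono norm_apply_le order_refl
        order_trans[OF A.norm_p(3) G\<phi>_diff] norm_diff_le_via[OF d(3)] C1b_lipschitz_le[OF jetD(7)[OF B.ks]] \<phi>_diff)
  finally show ?thesis by (simp add: algebra_simps)
qed

lemma \<theta>r'_diff:
  "norm (A.\<theta>r' x - B.\<theta>r' x) \<le> (Lg + Lc + \<epsilon> * (1 + Lc + a + Lr)) * d"
proof -
  have "A.\<theta>r' x - B.\<theta>r' x = (A.Pc o\<^sub>L (A.G' x - B.G' x))
      - ((kc' (A.Ar x) o\<^sub>L A.Ar' x) - (kc' (B.Ar x) o\<^sub>L B.Ar' x))"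
    unfolding A.\<theta>r'_def B.\<theta>r'_def
    by (intro blinfun_eqI) (simp add: A.lin[THEN bounded_linear.linear, THEN linear_diff] blinfun.diff_left blinfun.add_left)
  also have "norm \<dots> \<le> ((\<epsilon> * d) * (1 + Lc) + Lg * d) + ((\<epsilon> * d) * (a + Lr) + Lc * d)"
    by (intro order_trans[OF norm_triangle_ineq4] add_mono order_trans[OF A.norm_P_compose(1) G'_diff]
        norm_compose_diff_le C1b_lipschitz_le[OF jetD(5)[OF A.kc]] Ar_diff Ar'_diff A.Ar'_bound jetD(4)[OF A.kc])
  finally show ?thesis by (simp add: algebra_simps)
qed

text \<open>The factor exceeds \<theta>_{1,2} by two terms: one with \<delta>, from
  \<open>ku2'\<close> at the points \<open>A.Ar x\<close> and \<open>B.Ar x\<close>, and one with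
  \<epsilon>, from \<open>g'\<close> at two points.\<close>

lemma \<theta>u'_diff:
  "norm (A.\<theta>u' x - B.\<theta>u' x) \<le> (norm Aui * ((a + Lr) + Lg + Lu + \<delta> * (a + Lr) + \<epsilon> * (1 + Lc))) * d"
proof -
  have "A.\<theta>u' x - B.\<theta>u' x = (Aui o\<^sub>L ((ku' (A.Ar x) o\<^sub>L A.Ar' x) - (ku2' (B.Ar x) o\<^sub>L B.Ar' x)))
     - (Aui o\<^sub>L (A.Pu o\<^sub>L (A.G' x - B.G' x)))"
    unfolding A.\<theta>u'_def B.\<theta>u'_def
    by (intro blinfun_eqI) (simp add: A.lin[THEN bounded_linear.linear, THEN linear_diff] blinfun.diff_left blinfun.diff_right)
  also have "norm \<dots> \<le> norm Aui * ((d + \<delta> * d) * (a + Lr) + Lu * d) + norm Aui * ((\<epsilon> * d) * (1 + Lc) + Lg * d)"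
    by (intro order_trans[OF norm_triangle_ineq4] add_mono norm_compose_le order_refl
        order_trans[OF A.norm_P_compose(2) G'_diff]
        norm_compose_diff_le norm_diff_le_via[OF d'(2)] C1b_lipschitz_le[OF jetD(5)[OF B.ku]]
        Ar_diff Ar'_diff A.Ar'_bound jetD(4)[OF B.ku])
  finally show ?thesis by (simp add: algebra_simps)
qed

text \<open>Both the evaluation point \<open>\<phi> x\<close> and the inner derivative
  \<open>\<phi>' x\<close> vary with the argument. For \<epsilon> = \<delta> = 0 the factor reduces
  to \<theta>_{1,3}.\<close>

lemma \<theta>s'_diff:
  "norm (A.\<theta>s' x - B.\<theta>s' x) \<le>
     (norm As * ((1 + \<delta> * Lm) * Lm + Ls * (Lm * ((1 + \<delta> * Lm) * Lm)))
      + ((\<epsilon> * (1 + Lc) + Lg + \<gamma> * Lm) * Lm + Lg * (1 + Lc) * (Lm * ((1 + \<delta> * Lm) * Lm)))) * d"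
proof -
  have eq: "A.\<theta>s' x - B.\<theta>s' x = (As o\<^sub>L ((ks' (A.\<phi> x) o\<^sub>L A.\<phi>' x) - (ks2' (B.\<phi> x) o\<^sub>L B.\<phi>' x)))
     + (A.Ps o\<^sub>L ((A.G' (A.\<phi> x) o\<^sub>L A.\<phi>' x) - (B.G' (B.\<phi> x) o\<^sub>L B.\<phi>' x)))"
    unfolding A.\<theta>s'_def B.\<theta>s'_def
    by (intro blinfun_eqI) (simp add: A.lin[THEN bounded_linear.linear, THEN linear_diff]
      blinfun.diff_left blinfun.diff_right blinfun.add_left)
  have "norm (A.\<theta>s' x - B.\<theta>s' x) \<le> norm As * ((d + \<delta> * (Lm * d)) * Lm + Ls * (Lm * ((d + \<delta> * (Lm * d)) * Lm)))
     + ((((\<epsilon> * d) * (1 + Lc) + Lg * d) + \<gamma> * (Lm * d)) * Lm + Lg * (1 + Lc) * (Lm * ((d + \<delta> * (Lm * d)) * Lm)))"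
    unfolding eq
  proof (intro norm_triangle_mono norm_compose_le order_refl order_trans[OF A.norm_P_compose(3)])
    show "norm ((ks' (A.\<phi> x) o\<^sub>L A.\<phi>' x) - (ks2' (B.\<phi> x) o\<^sub>L B.\<phi>' x))
      \<le> (d + \<delta> * (Lm * d)) * Lm + Ls * (Lm * ((d + \<delta> * (Lm * d)) * Lm))"
      by (rule norm_compose_diff_le[OF norm_diff_le_via[OF d'(3) C1b_lipschitz_le[OF jetD(5)[OF B.ks] \<phi>_diff]]
            \<phi>'_diff A.\<phi>'_props(4) jetD(4)[OF B.ks]])
    show "norm ((A.G' (A.\<phi> x) o\<^sub>L A.\<phi>' x) - (B.G' (B.\<phi> x) o\<^sub>L B.\<phi>' x))
      \<le> (((\<epsilon> * d) * (1 + Lc) + Lg * d) + \<gamma> * (Lm * d)) * Lm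
        + Lg * (1 + Lc) * (Lm * ((d + \<delta> * (Lm * d)) * Lm))"
      by (rule norm_compose_diff_le[OF G'\<phi>_diff \<phi>'_diff A.\<phi>'_props(4) B.G'_bound])
  qed
  then show ?thesis by (simp add: algebra_simps)
qed

end

text \<open>The largest of the six factors just obtained. The first three are \<theta>_{0,i}, the
  last three become \<theta>_{1,i} at \<epsilon> = \<delta> = 0.\<close>

definition contraction_rate :: "real \<Rightarrow> real \<Rightarrow> real \<Rightarrow> real \<Rightarrow> real \<Rightarrow> real \<Rightarrow> real \<Rightarrow> real \<Rightarrow> real" where
  "contraction_rate Lg Lc a ai ui s \<epsilon> \<delta> =
    (let Lr = L_r Lg Lc a; Lu = L_u Lg Lc a ui; Ls = L_s Lg Lc a ai s; Lm = L_m1 Lg Lc a ai;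
         \<gamma> = \<epsilon> * (1 + Lc) * (1 + Lc) + Lg * max \<epsilon> \<delta>
     in max (Lg + Lc) (max (ui * (1 + Lg + Lu)) (max (s * (1 + Lm * Ls) + Lg * (1 + Lm * (1 + Lc)))
       (max (Lg + Lc + \<epsilon> * (1 + Lc + a + Lr))
       (max (ui * ((a + Lr) + Lg + Lu + \<delta> * (a + Lr) + \<epsilon> * (1 + Lc)))
       (s * ((1 + \<delta> * Lm) * Lm + Ls * (Lm * ((1 + \<delta> * Lm) * Lm)))
          + ((\<epsilon> * (1 + Lc) + Lg + \<gamma> * Lm) * Lm + Lg * (1 + Lc) * (Lm * ((1 + \<delta> * Lm) * Lm)))))))))"

lemma delta_ge:
  fixes \<epsilon> :: real
  assumes "S_cond 2 Lg Lc a ai ui s"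
  defines "\<delta> \<equiv> delta Lg Lc a ai ui s \<epsilon>"
  shows "C_1 Lg Lc a \<epsilon> \<le> (1 - theta1 2 Lg Lc) * \<delta>"
    and "C_2 Lg Lc ui \<epsilon> \<le> (1 - theta2 2 Lg Lc a ui) * \<delta>"
    and "C_3 Lg Lc a ai \<epsilon> \<le> (1 - theta3 2 Lg Lc a ai s) * \<delta>"
proof -
  have th: "theta1 2 Lg Lc < 1" "theta2 2 Lg Lc a ui < 1" "theta3 2 Lg Lc a ai s < 1"
    using assms(1) by (auto simp: S_cond_def)
  have "C_1 Lg Lc a \<epsilon> / (1 - theta1 2 Lg Lc) \<le> \<delta>" "C_2 Lg Lc ui \<epsilon> / (1 - theta2 2 Lg Lc a ui) \<le> \<delta>"
    "C_3 Lg Lc a ai \<epsilon> / (1 - theta3 2 Lg Lc a ai s) \<le> \<delta>"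
    unfolding \<delta>_def delta_def by auto
  then show "C_1 Lg Lc a \<epsilon> \<le> (1 - theta1 2 Lg Lc) * \<delta>" "C_2 Lg Lc ui \<epsilon> \<le> (1 - theta2 2 Lg Lc a ui) * \<delta>"
    "C_3 Lg Lc a ai \<epsilon> \<le> (1 - theta3 2 Lg Lc a ai s) * \<delta>"
    using th by (simp_all add: divide_le_eq mult.commute)
qed

text \<open>Each C_i is linear in \<epsilon> and the denominators are nonzero constants.\<close>

lemma tendsto_delta:
  assumes "S_cond 2 Lg Lc a ai ui s"
  shows "(delta Lg Lc a ai ui s \<longlongrightarrow> 0) (at_right 0)"
proof -
  have th: "1 - theta1 2 Lg Lc \<noteq> 0" "1 - theta2 2 Lg Lc a ui \<noteq> 0" "1 - theta3 2 Lg Lc a ai s \<noteq> 0"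
    using assms by (auto simp: S_cond_def)
  have "((\<lambda>\<epsilon>. delta Lg Lc a ai ui s \<epsilon>) \<longlongrightarrow> delta Lg Lc a ai ui s 0) (at_right 0)"
    unfolding delta_def C_1_def C_2_def C_3_def by (intro tendsto_intros tendsto_max th)
  moreover have "delta Lg Lc a ai ui s 0 = 0" by (simp add: delta_def C_1_def C_2_def C_3_def)
  ultimately show ?thesis by (simp only:)
qed

text \<open>The rate is continuous in \<epsilon> and \<delta>, and its value at (0, 0) is the
  largest \<theta>_{m,i} with m = 0, 1, hence below 1. Convergence of \<delta>(\<epsilon>) to 0
  carries the strict inequality to small \<epsilon>.\<close>

lemma eventually_contraction_rate_less_1:
  assumes S: "S_cond 2 Lg Lc a ai ui s"
  shows "\<forall>\<^sub>F \<epsilon> in at_right 0. contraction_rate Lg Lc a ai ui s \<epsilon> (delta Lg Lc a ai ui s \<epsilon>) < 1"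
proof -
  have th: "theta1 1 Lg Lc < 1" "theta2 0 Lg Lc a ui < 1" "theta3 0 Lg Lc a ai s < 1"
     "theta2 1 Lg Lc a ui < 1" "theta3 1 Lg Lc a ai s < 1"
    using S by (auto simp: S_cond_def)
  have id: "((\<lambda>\<epsilon>::real. \<epsilon>) \<longlongrightarrow> 0) (at_right 0)" by (rule tendsto_ident_at)
  note \<delta> = tendsto_delta[OF S]
  have "((\<lambda>\<epsilon>. contraction_rate Lg Lc a ai ui s \<epsilon> (delta Lg Lc a ai ui s \<epsilon>))
     \<longlongrightarrow> contraction_rate Lg Lc a ai ui s 0 0) (at_right 0)"
    unfolding contraction_rate_def Let_def
    by (intro tendsto_max tendsto_add tendsto_mult tendsto_const id \<delta>)
  moreover have "contraction_rate Lg Lc a ai ui s 0 0 < 1"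
    unfolding contraction_rate_def Let_def max_less_iff_conj
  proof (intro conjI)
    \<comment> \<open>Without the vanishing terms one factor \<open>L_m1\<close> can be extracted,
      leaving \<theta>_{1,3}.\<close>
    show "s * ((1 + 0 * L_m1 Lg Lc a ai) * L_m1 Lg Lc a ai + L_s Lg Lc a ai s * (L_m1 Lg Lc a ai * ((1 + 0 * L_m1 Lg Lc a ai) * L_m1 Lg Lc a ai)))
        + ((0 * (1 + Lc) + Lg + (0 * (1 + Lc) * (1 + Lc) + Lg * max 0 0) * L_m1 Lg Lc a ai) * L_m1 Lg Lc a ai
        + Lg * (1 + Lc) * (L_m1 Lg Lc a ai * ((1 + 0 * L_m1 Lg Lc a ai) * L_m1 Lg Lc a ai))) < 1"
      using th(5) by (simp add: theta3_def) (simp add: algebra_simps)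
  qed (use th in \<open>simp_all add: theta1_def theta2_def theta3_def\<close>)
  ultimately show ?thesis by (rule order_tendstoD(2))
qed

context graph_transform_pair
begin

lemma Cnorm_Theta_diff_le:
  assumes "C_1 Lg Lc a \<epsilon> \<le> (1 - theta1 2 Lg Lc) * \<delta>"
    and "C_2 Lg Lc (norm Aui) \<epsilon> \<le> (1 - theta2 2 Lg Lc a (norm Aui)) * \<delta>"
    and "C_3 Lg Lc a (norm Aci) \<epsilon> \<le> (1 - theta3 2 Lg Lc a (norm Aci) (norm As)) * \<delta>"
  shows "Cnorm 1 (\<lambda>y. emb jc ju js (A.\<theta>r, A.\<theta>u, A.\<theta>s) y - emb jc ju js (B.\<theta>r, B.\<theta>u, B.\<theta>s) y)
    \<le> contraction_rate Lg Lc a (norm Aci) (norm Aui) (norm As) \<epsilon> \<delta> * d" (is "_ \<le> ?q * d")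
proof -
  have le: "x \<le> ?q * d" if "x \<le> p * d" "p \<le> ?q" for x p
    using that mult_right_mono[OF that(2) d_nonneg] by linarith
  show ?thesis
    unfolding A.Cnorm_diff_le_iff[OF A.\<theta>r_jet[OF assms(1)] A.\<theta>u_jet[OF assms(2)] A.\<theta>s_jet[OF assms(3)]
      B.\<theta>r_jet[OF assms(1)] B.\<theta>u_jet[OF assms(2)] B.\<theta>s_jet[OF assms(3)]]
    by (intro allI conjI le[OF \<theta>r_diff] le[OF \<theta>u_diff] le[OF \<theta>s_diff]
          le[OF \<theta>r'_diff] le[OF \<theta>u'_diff] le[OF \<theta>s'_diff])
       (simp_all only: contraction_rate_def Let_def \<gamma>_def le_max_iff_disj order_refl simp_thms)
qed

end

section \<open>Return from chosen derivatives to the set Gamma_1\<close>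

context graph_transform
begin

lemma Gamma1_imp_arg:
  assumes "\<Lambda> \<in> Gamma1 jc ju js Lr Lu Ls \<delta>"
  shows "\<exists>r ku ks r' ku' ks'. \<Lambda> = (r, ku, ks) \<and>
    graph_transform_arg pc pu ps jc ju js Lg Lc Ac Aci Aui As g g' kc kc' \<epsilon> \<delta> r ku ks r' ku' ks'"
proof -
  obtain r ku ks where \<Lambda>: "\<Lambda> = (r, ku, ks)" by (rule prod_cases3)
  obtain r' ku' ks' where j: "jet r r' Lr \<delta>" "jet ku ku' Lu \<delta>" "jet ks ks' Ls \<delta>"
    using assms unfolding \<Lambda> Gamma1_iff by blast
  have "graph_transform_arg pc pu ps jc ju js Lg Lc Ac Aci Aui As g g' kc kc' \<epsilon> \<delta> r ku ks r' ku' ks'"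
    by (rule graph_transform_arg.intro[OF graph_transform_axioms graph_transform_arg_axioms.intro[OF j]])
  with \<Lambda> show ?thesis by blast
qed

abbreviation "\<delta>\<epsilon> \<equiv> delta Lg Lc (norm Ac) (norm Aci) (norm Aui) (norm As) \<epsilon>"

lemmas \<delta>\<epsilon>_ge = delta_ge[OF S2, of \<epsilon>]

lemma Theta_Gamma1:
  assumes "\<Lambda> \<in> Gamma1 jc ju js Lr Lu Ls \<delta>\<epsilon>"
  shows "Theta Ac Aui As jc ju js (pc \<circ> g) (pu \<circ> g) (ps \<circ> g) kc \<Lambda> \<in> Gamma1 jc ju js Lr Lu Ls \<delta>\<epsilon>"
proof -
  obtain r ku ks r' ku' ks' where \<Lambda>: "\<Lambda> = (r, ku, ks)" and
    A: "graph_transform_arg pc pu ps jc ju js Lg Lc Ac Aci Aui As g g' kc kc' \<epsilon> \<delta>\<epsilon> r ku ks r' ku' ks'"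
    using Gamma1_imp_arg[OF assms] by blast
  note jets = graph_transform_arg.\<theta>r_jet[OF A \<delta>\<epsilon>_ge(1)] graph_transform_arg.\<theta>u_jet[OF A \<delta>\<epsilon>_ge(2)]
    graph_transform_arg.\<theta>s_jet[OF A \<delta>\<epsilon>_ge(3)]
  show ?thesis
    unfolding \<Lambda> graph_transform_arg.Theta_eq[OF A] Gamma1_iff
    using jets by blast
qed

lemma Cnorm_Theta_diff_le:
  assumes "\<Lambda> \<in> Gamma1 jc ju js Lr Lu Ls \<delta>\<epsilon>" "\<Lambda>' \<in> Gamma1 jc ju js Lr Lu Ls \<delta>\<epsilon>"
  defines "\<Theta> \<equiv> Theta Ac Aui As jc ju js (pc \<circ> g) (pu \<circ> g) (ps \<circ> g) kc"
  shows "Cnorm 1 (\<lambda>y. emb jc ju js (\<Theta> \<Lambda>) y - emb jc ju js (\<Theta> \<Lambda>') y)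
    \<le> contraction_rate Lg Lc (norm Ac) (norm Aci) (norm Aui) (norm As) \<epsilon> \<delta>\<epsilon>
      * Cnorm 1 (\<lambda>y. emb jc ju js \<Lambda> y - emb jc ju js \<Lambda>' y)"
proof -
  obtain r ku ks r' ku' ks' where \<Lambda>: "\<Lambda> = (r, ku, ks)" and
    A: "graph_transform_arg pc pu ps jc ju js Lg Lc Ac Aci Aui As g g' kc kc' \<epsilon> \<delta>\<epsilon> r ku ks r' ku' ks'"
    using Gamma1_imp_arg[OF assms(1)] by blast
  obtain r2 ku2 ks2 r2' ku2' ks2' where \<Lambda>': "\<Lambda>' = (r2, ku2, ks2)" and
    B: "graph_transform_arg pc pu ps jc ju js Lg Lc Ac Aci Aui As g g' kc kc' \<epsilon> \<delta>\<epsilon> r2 ku2 ks2 r2' ku2' ks2'"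
    using Gamma1_imp_arg[OF assms(2)] by blast
  define d where "d = Cnorm 1 (\<lambda>y. emb jc ju js (r, ku, ks) y - emb jc ju js (r2, ku2, ks2) y)"
  \<comment> \<open>The equivalence is read with the C1 distance itself as the bound, where its left
    side is reflexivity.\<close>
  have d: "\<forall>y. norm (r y - r2 y) \<le> d \<and> norm (ku y - ku2 y) \<le> d \<and> norm (ks y - ks2 y) \<le> d
      \<and> norm (r' y - r2' y) \<le> d \<and> norm (ku' y - ku2' y) \<le> d \<and> norm (ks' y - ks2' y) \<le> d"
    by (rule iffD1[OF Cnorm_diff_le_iff[OF graph_transform_arg.r[OF A] graph_transform_arg.ku[OF A] graph_transform_arg.ks[OF A]
        graph_transform_arg.r[OF B] graph_transform_arg.ku[OF B] graph_transform_arg.ks[OF B]] eq_refl[OF d_def[symmetric]]])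
  have P: "graph_transform_pair pc pu ps jc ju js Lg Lc Ac Aci Aui As g g' kc kc' \<epsilon> \<delta>\<epsilon>
      r ku ks r' ku' ks' r2 ku2 ks2 r2' ku2' ks2' d"
    by (intro graph_transform_pair.intro[OF A B] graph_transform_pair_axioms.intro) (simp_all add: d)
  show ?thesis
    unfolding \<Lambda> \<Lambda>' \<Theta>_def graph_transform_arg.Theta_eq[OF A] graph_transform_arg.Theta_eq[OF B] d_def[symmetric]
    by (rule graph_transform_pair.Cnorm_Theta_diff_le[OF P \<delta>\<epsilon>_ge])
qed

end

theorem theorem3p9:
  fixes n :: nat and Lg Lc :: real
    and pc :: "'x::banach \<Rightarrow> 'c::banach" and pu :: "'x \<Rightarrow> 'u::banach" and ps :: "'x \<Rightarrow> 's::banach"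
    and jc :: "'c \<Rightarrow> 'x" and ju :: "'u \<Rightarrow> 'x" and js :: "'s \<Rightarrow> 'x"
    and Ac Aci :: "'c \<Rightarrow>\<^sub>L 'c" and Au Aui :: "'u \<Rightarrow>\<^sub>L 'u" and As :: "'s \<Rightarrow>\<^sub>L 's"
  assumes lin: "bounded_linear pc" "bounded_linear pu" "bounded_linear ps"
      "bounded_linear jc" "bounded_linear ju" "bounded_linear js"
    and proj_c: "\<And>a. pc (jc a) = a" "\<And>a. pu (jc a) = 0" "\<And>a. ps (jc a) = 0"
    and proj_u: "\<And>a. pc (ju a) = 0" "\<And>a. pu (ju a) = a" "\<And>a. ps (ju a) = 0"
    and proj_s: "\<And>a. pc (js a) = 0" "\<And>a. pu (js a) = 0" "\<And>a. ps (js a) = a"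
    and decomp: "\<And>x. x = jc (pc x) + ju (pu x) + js (ps x)"
    and maxnorm: "\<And>x. norm x = max (norm (pc x)) (max (norm (pu x)) (norm (ps x)))"
    and inv_c: "Ac o\<^sub>L Aci = id_blinfun" "Aci o\<^sub>L Ac = id_blinfun"
    and inv_u: "Au o\<^sub>L Aui = id_blinfun" "Aui o\<^sub>L Au = id_blinfun"
    and n2: "2 \<le> n"
    and spec: "\<And>m. 1 \<le> m \<Longrightarrow> m \<le> n \<Longrightarrow>
                 norm Aci ^ m * norm As < 1 \<and> norm Aui * norm Ac ^ m < 1"
    and Lg0: "0 \<le> Lg" and Lc0: "0 \<le> Lc"
    and S2: "S_cond 2 Lg Lc (norm Ac) (norm Aci) (norm Aui) (norm As)"
  shows "\<exists>\<epsilon>0>0. \<forall>\<epsilon>. 0 < \<epsilon> \<and> \<epsilon> < \<epsilon>0 \<longrightarrow>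
    (\<forall>(g :: 'x \<Rightarrow> 'x) (kc :: 'c \<Rightarrow> 'c).
       Cb n g \<and> g 0 = 0 \<and> (g has_derivative (\<lambda>h. 0)) (at 0) \<and> Dsup 1 g \<le> Lg \<and>
       Cb n kc \<and> kc 0 = 0 \<and> (kc has_derivative (\<lambda>h. 0)) (at 0) \<and> Dsup 1 kc \<le> Lc \<and>
       Dsup 2 g \<le> \<epsilon> \<and> Dsup 2 kc \<le> \<epsilon> \<longrightarrow>
       (let a = norm Ac; ai = norm Aci; ui = norm Aui; s = norm As;
            \<Gamma> = Gamma1 jc ju js (L_r Lg Lc a) (L_u Lg Lc a ui) (L_s Lg Lc a ai s)
                   (delta Lg Lc a ai ui s \<epsilon>);
            \<Theta> = Theta Ac Aui As jc ju js (pc \<circ> g) (pu \<circ> g) (ps \<circ> g) kc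
        in (\<forall>\<Lambda>\<in>\<Gamma>. \<Theta> \<Lambda> \<in> \<Gamma>) \<and>
           (\<exists>q<1. \<forall>\<Lambda>\<in>\<Gamma>. \<forall>\<Lambda>'\<in>\<Gamma>.
              Cnorm 1 (\<lambda>y. emb jc ju js (\<Theta> \<Lambda>) y - emb jc ju js (\<Theta> \<Lambda>') y)
                \<le> q * Cnorm 1 (\<lambda>y. emb jc ju js \<Lambda> y - emb jc ju js \<Lambda>' y))))"
proof -
  have sp: "splitting pc pu ps jc ju js"
    by (rule splitting.intro) fact+
  \<comment> \<open>The threshold depends on the constants alone, so it can be fixed before g and
    k_c are introduced.\<close>
  obtain \<epsilon>0 where \<epsilon>0: "\<epsilon>0 > 0" and rate: "\<And>\<epsilon>. 0 < \<epsilon> \<Longrightarrow> \<epsilon> < \<epsilon>0 \<Longrightarrow>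
    contraction_rate Lg Lc (norm Ac) (norm Aci) (norm Aui) (norm As) \<epsilon>
      (delta Lg Lc (norm Ac) (norm Aci) (norm Aui) (norm As) \<epsilon>) < 1"
    using eventually_contraction_rate_less_1[OF S2] unfolding eventually_at_right_field by blast
  show ?thesis
    unfolding Let_def
  proof (intro exI[of _ \<epsilon>0] conjI[OF \<epsilon>0] allI impI, elim conjE)
    fix \<epsilon> and g :: "'x \<Rightarrow> 'x" and kc :: "'c \<Rightarrow> 'c"
    assume \<epsilon>: "0 < \<epsilon>" "\<epsilon> < \<epsilon>0"
      and g: "Cb n g" "g 0 = 0" "(g has_derivative (\<lambda>h. 0)) (at 0)" "Dsup 1 g \<le> Lg" "Dsup 2 g \<le> \<epsilon>"
      and kc: "Cb n kc" "kc 0 = 0" "(kc has_derivative (\<lambda>h. 0)) (at 0)" "Dsup 1 kc \<le> Lc" "Dsup 2 kc \<le> \<epsilon>"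
    obtain g' where g': "jet g g' Lg \<epsilon>"
      using iffD2[OF jet_iff_Cb, of g Lg \<epsilon>] g Cb_mono[OF g(1) n2] by blast
    obtain kc' where kc': "jet kc kc' Lc \<epsilon>"
      using iffD2[OF jet_iff_Cb, of kc Lc \<epsilon>] kc Cb_mono[OF kc(1) n2] by blast
    have gt: "graph_transform pc pu ps jc ju js Lg Lc Ac Aci Aui As g g' kc kc' \<epsilon>"
      by (rule graph_transform.intro[OF sp graph_transform_axioms.intro[OF inv_c Lg0 Lc0 S2 g' kc']])
    let ?\<Gamma> = "Gamma1 jc ju js (L_r Lg Lc (norm Ac)) (L_u Lg Lc (norm Ac) (norm Aui))
        (L_s Lg Lc (norm Ac) (norm Aci) (norm As)) (delta Lg Lc (norm Ac) (norm Aci) (norm Aui) (norm As) \<epsilon>)"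
    let ?\<Theta> = "Theta Ac Aui As jc ju js (pc \<circ> g) (pu \<circ> g) (ps \<circ> g) kc"
    show "(\<forall>\<Lambda>\<in>?\<Gamma>. ?\<Theta> \<Lambda> \<in> ?\<Gamma>) \<and> (\<exists>q<1. \<forall>\<Lambda>\<in>?\<Gamma>. \<forall>\<Lambda>'\<in>?\<Gamma>.
        Cnorm 1 (\<lambda>y. emb jc ju js (?\<Theta> \<Lambda>) y - emb jc ju js (?\<Theta> \<Lambda>') y)
          \<le> q * Cnorm 1 (\<lambda>y. emb jc ju js \<Lambda> y - emb jc ju js \<Lambda>' y))"
    \<comment> \<open>The factor q is left schematic; the bound \<open>rate\<close> instantiates it
      with the contraction rate at this \<epsilon>, independent of the two arguments.\<close>
    proof (intro conjI ballI exI)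
      show "?\<Theta> \<Lambda> \<in> ?\<Gamma>" if "\<Lambda> \<in> ?\<Gamma>" for \<Lambda>
        by (rule graph_transform.Theta_Gamma1[OF gt that])
    qed (rule rate[OF \<epsilon>], rule graph_transform.Cnorm_Theta_diff_le[OF gt])
  qed
qed

end
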